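(* Let $d\ge1$ and let $(\mathbf X,Y)$ be a random vector in $\mathbb R^d\times\mathbb R$ with $\mathbb E[Y^2]<\infty$. Suppose that $\mathbf X=(X_1,\dots,X_d)$ is purely atomic with finite support, and that for some $N>0$, $$\max_{j\in[d]}\max_{u\in\mathbb R}\mathbb P(X_j=u)\le\frac1N.$$ Let $\Delta Y:=\sup\operatorname{supp}Y-\inf\operatorname{supp}Y$, where $\operatorname{supp} Y$ is the support of $Y$, and let $\{M_k\}_{k\ge0}$ be the process associated with $(\mathbf X,Y)$ constructed from the cyclic MinimaxSplit algorithm. Then for every $\delta>0$ and every integer $k\ge0$, $$\mathbb E[(Y-M_k)^2]\le(1+\delta^{-1})2^{-2\lfloor k/d\rfloor/3}\frac{2^{k+2}(\Delta Y)^2}{3N}+\inf_{g\in\mathcal G}\Bigg(\Big((1+\delta)+\frac{2(1+\delta)(1+\delta^{-1})}{3\cdot2^{2\lfloor k/d\rfloor/3}}\Big)\mathbb E[(Y-g(\mathbf X))^2]+(1+\delta^{-1})\bigg(\frac23+\Big(\frac{1+\delta^{-1}}4\Big)^{2/3}\bigg)2^{-2\lfloor k/d\rfloor/3}\|g\|_{\mathrm{TV}}^2\Bigg).$$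
   Context: Write $[d]=\{1,\dots,d\}$. A set $A\subseteq\mathbb R^d$ is unsplittable if $\mathbb P(\mathbf X\in A)=0$, or if $\mathbb P(\mathbf X\in A)>0$ and the conditional law of $Y$ given $\mathbf X\in A$ is a point mass, or if $\mathbb P(\mathbf X\in A)>0$ and the conditional law of $\mathbf X$ given $\mathbf X\in A$ is a point mass. Otherwise $A$ is splittable. Cyclic MinimaxSplit algorithm: nested partitions $\{\pi_k\}_{k\ge0}$ of $\mathbb R^d$ into axis-aligned boxes $A=[a_1,b_1)\times\dots\times[a_d,b_d)$ (with $a_i,b_i\in\mathbb R\cup\{\pm\infty\}$ and $[-\infty,b)$ read as $(-\infty,b)$) are built recursively. $\pi_0=\{\mathbb R^d\}$. Given $\pi_k$, let $j=1+(k \bmod d)$. Every unsplittable $A\in\pi_k$ is kept as an element of $\pi_{k+1}$. Every splittable $A\in\pi_k$ is replaced in $\pi_{k+1}$ by $A\cap\{x_j<\hat x_j\}$ and $A\cap\{x_j\ge\hat x_j\}$, where $$\hat x_j\in\operatorname*{arg\,min}_{x_j\in[a_j,b_j)}\max\big\{\mathbb P(\mathbf X\in A,X_j<x_j)\operatorname{Var}(Y\mid \mathbf X\in A,X_j<x_j),\ \mathbb P(\mathbf X\in A,X_j\ge x_j)\operatorname{Var}(Y\mid\mathbf X\in A,X_j\ge x_j)\big\},$$ ties being broken arbitrarily (products with a zero-probability event are $0$). The associated process is $M_k=\mathbb E[Y\mid\mathbf X\in A]$ on the event $\{\mathbf X\in A\}$, for $A\in\pi_k$. $\mathcal G$ is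 the class of additive functions $g(\mathbf x)=g_1(x_1)+\dots+g_d(x_d)$ on $\mathbb R^d$ with each $g_i:\mathbb R\to\mathbb R$ of bounded variation, and $\|g\|_{\mathrm{TV}}$ is the infimum of $\sum_{i=1}^d\|g_i\|_{\mathrm{TV}}$ over all such additive representations of $g$, where $\|g_i\|_{\mathrm{TV}}$ is the total variation of $g_i$. *)

theory Defs
  imports "HOL-Probability.Probability"
begin

(* A point of R^d is an extensional function on {1..d}. Naming the coordinates by numbers is what
   allows the algorithm to cycle through them. *)

abbreviation Rd :: "nat \<Rightarrow> (nat \<Rightarrow> real) set" where
  "Rd d \<equiv> {1..d} \<rightarrow>\<^sub>E UNIV"

abbreviation borel_Rd :: "nat \<Rightarrow> (nat \<Rightarrow> real) measure" where
  "borel_Rd d \<equiv> (\<Pi>\<^sub>M i\<in>{1..d}. borel)"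

(* If a i = -\<infinity> then the i-th side is the open ray below b i, since points have real coordinates. *)
definition box_Rd :: "nat \<Rightarrow> (nat \<Rightarrow> ereal) \<Rightarrow> (nat \<Rightarrow> ereal) \<Rightarrow> (nat \<Rightarrow> real) set" where
  "box_Rd d a b = {x \<in> Rd d. \<forall>i\<in>{1..d}. a i \<le> ereal (x i) \<and> ereal (x i) < b i}"


definition law_support :: "'a measure \<Rightarrow> ('a \<Rightarrow> 'b::topological_space) \<Rightarrow> 'b set" where
  "law_support M Z =
     {z. \<forall>U. open U \<and> z \<in> U \<longrightarrow> measure M {\<omega> \<in> space M. Z \<omega> \<in> U} > 0}"

definition law_atoms :: "'a measure \<Rightarrow> ('a \<Rightarrow> 'b) \<Rightarrow> 'b set" where
  "law_atoms M Z = {z. measure M {\<omega> \<in> space M. Z \<omega> = z} > 0}"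

definition purely_atomic :: "'a measure \<Rightarrow> ('a \<Rightarrow> 'b) \<Rightarrow> bool" where
  "purely_atomic M Z \<longleftrightarrow> (AE \<omega> in M. Z \<omega> \<in> law_atoms M Z)"

definition support_width :: "'a measure \<Rightarrow> ('a \<Rightarrow> real) \<Rightarrow> ereal" where
  "support_width M Y = Sup (ereal ` law_support M Y) - Inf (ereal ` law_support M Y)"


(* For an event E of positive probability, uniform_measure M E is the conditional probability
   given E; if E is a null event, it is the zero measure and both quantities below are 0. *)

definition cond_mean :: "'a measure \<Rightarrow> ('a \<Rightarrow> real) \<Rightarrow> 'a set \<Rightarrow> real" where
  "cond_mean M Y E = (\<integral>\<omega>. Y \<omega> \<partial>uniform_measure M E)"

definition cond_var :: "'a measure \<Rightarrow> ('a \<Rightarrow> real) \<Rightarrow> 'a set \<Rightarrow> real" where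
  "cond_var M Y E = (\<integral>\<omega>. (Y \<omega> - cond_mean M Y E)\<^sup>2 \<partial>uniform_measure M E)"

definition cell_event :: "'a measure \<Rightarrow> ('a \<Rightarrow> nat \<Rightarrow> real) \<Rightarrow> (nat \<Rightarrow> real) set \<Rightarrow> 'a set" where
  "cell_event M X A = {\<omega> \<in> space M. X \<omega> \<in> A}"

definition unsplittable ::
    "'a measure \<Rightarrow> nat \<Rightarrow> ('a \<Rightarrow> nat \<Rightarrow> real) \<Rightarrow> ('a \<Rightarrow> real) \<Rightarrow> (nat \<Rightarrow> real) set \<Rightarrow> bool" where
  "unsplittable M d X Y A \<longleftrightarrow>
     (let E = cell_event M X A in
        measure M E = 0
      \<or> (measure M E > 0 \<and> (\<exists>c. distr (uniform_measure M E) borel Y = return borel c))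
      \<or> (measure M E > 0 \<and>
          (\<exists>c\<in>Rd d. distr (uniform_measure M E) (borel_Rd d) X = return (borel_Rd d) c)))"

definition minimax_objective ::
    "'a measure \<Rightarrow> ('a \<Rightarrow> nat \<Rightarrow> real) \<Rightarrow> ('a \<Rightarrow> real) \<Rightarrow> (nat \<Rightarrow> real) set \<Rightarrow> nat \<Rightarrow> real \<Rightarrow> real" where
  "minimax_objective M X Y A j s =
     (let L = cell_event M X {x \<in> A. x j < s}; R = cell_event M X {x \<in> A. x j \<ge> s} in
        max (measure M L * cond_var M Y L) (measure M R * cond_var M Y R))"

(* A splittable box is nonempty, so its side [a j, b j) is determined by the set A. *)
definition minimax_threshold ::
    "'a measure \<Rightarrow> nat \<Rightarrow> ('a \<Rightarrow> nat \<Rightarrow> real) \<Rightarrow> ('a \<Rightarrow> real) \<Rightarrow> (nat \<Rightarrow> real) set \<Rightarrow> nat \<Rightarrow> real \<Rightarrow> bool"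
  where
  "minimax_threshold M d X Y A j s \<longleftrightarrow>
     (\<exists>a b. A = box_Rd d a b \<and>
        is_arg_min (minimax_objective M X Y A j) (\<lambda>t. a j \<le> ereal t \<and> ereal t < b j) s)"

definition minimax_step ::
    "'a measure \<Rightarrow> nat \<Rightarrow> ('a \<Rightarrow> nat \<Rightarrow> real) \<Rightarrow> ('a \<Rightarrow> real) \<Rightarrow> nat \<Rightarrow>
     (nat \<Rightarrow> real) set set \<Rightarrow> (nat \<Rightarrow> real) set set \<Rightarrow> bool" where
  "minimax_step M d X Y j P P' \<longleftrightarrow>
     (\<exists>s. (\<forall>A\<in>P. \<not> unsplittable M d X Y A \<longrightarrow> minimax_threshold M d X Y A j (s A)) \<and>
        P' = {A \<in> P. unsplittable M d X Y A} \<union>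
             (\<Union>A\<in>{A \<in> P. \<not> unsplittable M d X Y A}.
                {{x \<in> A. x j < s A}, {x \<in> A. x j \<ge> s A}}))"

(* Ties are broken arbitrarily: every sequence of partitions obtained from some choice of
   minimisers satisfies this predicate. *)
definition cyclic_minimax_split ::
    "'a measure \<Rightarrow> nat \<Rightarrow> ('a \<Rightarrow> nat \<Rightarrow> real) \<Rightarrow> ('a \<Rightarrow> real) \<Rightarrow>
     (nat \<Rightarrow> (nat \<Rightarrow> real) set set) \<Rightarrow> bool" where
  "cyclic_minimax_split M d X Y \<pi> \<longleftrightarrow>
     \<pi> 0 = {Rd d} \<and> (\<forall>k. minimax_step M d X Y (1 + k mod d) (\<pi> k) (\<pi> (Suc k)))"

definition associated_process ::
    "'a measure \<Rightarrow> ('a \<Rightarrow> nat \<Rightarrow> real) \<Rightarrow> ('a \<Rightarrow> real) \<Rightarrow>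
     (nat \<Rightarrow> (nat \<Rightarrow> real) set set) \<Rightarrow> (nat \<Rightarrow> 'a \<Rightarrow> real) \<Rightarrow> bool" where
  "associated_process M X Y \<pi> Mk \<longleftrightarrow>
     (\<forall>k. \<forall>A\<in>\<pi> k. \<forall>\<omega>\<in>cell_event M X A. Mk k \<omega> = cond_mean M Y (cell_event M X A))"


definition total_variation :: "(real \<Rightarrow> real) \<Rightarrow> ereal" where
  "total_variation f =
     Sup {ereal (\<Sum>i<n. \<bar>f (t (Suc i)) - f (t i)\<bar>) | (n::nat) (t::nat \<Rightarrow> real). mono t}"

(* The components of the additive representations of g with components of bounded variation. *)
definition additive_reps ::
    "nat \<Rightarrow> ((nat \<Rightarrow> real) \<Rightarrow> real) \<Rightarrow> (nat \<Rightarrow> real \<Rightarrow> real) set" where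
  "additive_reps d g =
     {h. (\<forall>i\<in>{1..d}. total_variation (h i) < \<infinity>) \<and> (\<forall>x\<in>Rd d. g x = (\<Sum>i\<in>{1..d}. h i (x i)))}"

definition additive_BV :: "nat \<Rightarrow> ((nat \<Rightarrow> real) \<Rightarrow> real) set" where
  "additive_BV d = {g. additive_reps d g \<noteq> {}}"

definition TV_norm :: "nat \<Rightarrow> ((nat \<Rightarrow> real) \<Rightarrow> real) \<Rightarrow> ereal" where
  "TV_norm d g = (INF h\<in>additive_reps d g. \<Sum>i\<in>{1..d}. total_variation (h i))"

end

theory Submission
  imports Defs
begin

text \<open>
  Let \<open>V(A) = P(X \<in> A) Var(Y | X \<in> A)\<close>, the least value of \<open>E[(Y - c)\<^sup>2; X \<in> A]\<close> over constants \<open>c\<close>; then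
  \<open>E[(Y - M\<^sub>k)\<^sup>2]\<close> is the sum of \<open>V(A)\<close> over the cells at depth \<open>k\<close>.

  Since \<open>V\<close> is superadditive and an atom of \<open>X\<^sub>j\<close> contributes at most \<open>W/N\<close> with \<open>W = (\<Delta>Y)\<^sup>2\<close>, some
  threshold leaves both halves of a cell with at most \<open>V(A)/2 + W/N\<close>. Hence every cell at depth \<open>k\<close>
  satisfies \<open>V(A) \<le> v\<close>, where \<open>v = V(R\<^sup>d)/2\<^sup>k + 2W/N\<close>.

  Let \<open>D(A)\<close> be the sum over the coordinates of the variation of the component \<open>g\<^sub>j\<close> over the \<open>j\<close>-th
  projection of \<open>A\<close>. A split in coordinate \<open>j\<close> does not increase the total of the \<open>j\<close>-th terms, and any
  other split at most doubles it, so the sum of \<open>D(A)\<close> over the cells is at most \<open>2\<^bsup>k-K\<^esup> \<parallel>g\<parallel>\<close> with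
  \<open>K = \<lfloor>k/d\<rfloor>\<close>. With \<open>c = 1 + 1/\<delta>\<close>, comparing \<open>Y\<close> to the midpoint of the range of \<open>g\<close> on \<open>A\<close> gives
  \<open>V(A) \<le> (1 + \<delta>) E[(Y - g(X))\<^sup>2; X \<in> A] + c P(A) D(A)\<^sup>2/4\<close>.

  Interpolating with \<open>min v w \<le> v\<^bsup>2/3\<^esup> w\<^bsup>1/3\<^esup>\<close>, the excess of \<open>V(A)\<close> over its first term is at most
  \<open>v\<^bsup>2/3\<^esup> (c P(A) D(A)\<^sup>2/4)\<^bsup>1/3\<^esup>\<close>; Hoelder's inequality sums these to
  \<open>(c/4)\<^bsup>1/3\<^esup> (v 2\<^bsup>k-K\<^esup> \<parallel>g\<parallel>)\<^bsup>2/3\<^esup>\<close>, which carries the factor \<open>2\<^bsup>-2K/3\<^esup>\<close>, and Young's inequality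
  separates the remaining product.
\<close>

section \<open>Risk of an event\<close>

text \<open>For the event of a cell this is \<open>V(A)\<close> of the overview. As a product it
  vanishes on null events, whatever the conditional variance is.\<close>

definition risk :: "'a measure \<Rightarrow> ('a \<Rightarrow> real) \<Rightarrow> 'a set \<Rightarrow> real" where
  "risk M Y E = measure M E * cond_var M Y E"

locale square_integrable_rv = prob_space M for M :: "'a measure" +
  fixes Y :: "'a \<Rightarrow> real"
  assumes Y_measurable [measurable]: "Y \<in> borel_measurable M"
    and integrable_Y_sq: "integrable M (\<lambda>\<omega>. (Y \<omega>)\<^sup>2)"
begin

lemma integrable_Y: "integrable M Y"
  using square_integrable_imp_integrable[OF Y_measurable integrable_Y_sq] .

lemma integrable_dev: "integrable M (\<lambda>\<omega>. (Y \<omega> - c)\<^sup>2)"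
proof -
  have "integrable M (\<lambda>\<omega>. (Y \<omega>)\<^sup>2 - 2 * c * Y \<omega> + c\<^sup>2)"
    using integrable_Y integrable_Y_sq by simp
  then show ?thesis
    by (simp add: power2_diff algebra_simps)
qed

lemma set_integrable_of_integrable:
  fixes f :: "'a \<Rightarrow> real"
  assumes "E \<in> events" "integrable M f"
  shows "set_integrable M E f"
  using assms unfolding set_integrable_def by (rule integrable_mult_indicator)

lemma integral_uniform_measure:
  fixes f :: "'a \<Rightarrow> real"
  assumes [measurable]: "E \<in> events" "f \<in> borel_measurable M" and "prob E \<noteq> 0"
  shows "(\<integral>\<omega>. f \<omega> \<partial>uniform_measure M E) = (LINT \<omega>:E|M. f \<omega>) / prob E"
proof -
  have pos: "prob E > 0"
    using assms(3) by (simp add: zero_less_measure_iff)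
  have "uniform_measure M E = density M (\<lambda>\<omega>. ennreal (indicator E \<omega> / prob E))"
    unfolding uniform_measure_def using pos
    by (intro density_cong) (auto simp: emeasure_eq_measure divide_ennreal split: split_indicator
        simp flip: ennreal_indicator ennreal_1)
  then have "(\<integral>\<omega>. f \<omega> \<partial>uniform_measure M E) = (\<integral>\<omega>. indicator E \<omega> / prob E * f \<omega> \<partial>M)"
    by (simp add: integral_real_density)
  also have "\<dots> = (\<integral>\<omega>. (indicator E \<omega> * f \<omega>) / prob E \<partial>M)"
    by simp
  finally show ?thesis
    unfolding set_lebesgue_integral_def by simp
qed

lemma risk_eq_dev:
  assumes "E \<in> events"
  shows "risk M Y E = (LINT \<omega>:E|M. (Y \<omega> - cond_mean M Y E)\<^sup>2)"
proof (cases "prob E = 0")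
  case True
  then have "AE \<omega> in M. \<omega> \<notin> E"
    using assms by (simp add: prob_eq_0)
  then have "AE \<omega> in M. indicator E \<omega> *\<^sub>R (Y \<omega> - cond_mean M Y E)\<^sup>2 = 0"
    by eventually_elim simp
  then have "(LINT \<omega>:E|M. (Y \<omega> - cond_mean M Y E)\<^sup>2) = 0"
    unfolding set_lebesgue_integral_def by (rule integral_eq_zero_AE)
  with True show ?thesis
    by (simp add: risk_def)
next
  case False
  then show ?thesis
    using assms by (simp add: risk_def cond_var_def integral_uniform_measure)
qed

text \<open>Bias-variance identity. With \<open>m\<close> the conditional mean, the squared
  deviations about \<open>c\<close> and about \<open>m\<close> differ by an affine function of
  \<open>Y\<close>, so only the integral of \<open>Y\<close> over the event is needed. On a null
  event every term is 0.\<close>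

lemma dev_eq_risk:
  assumes E: "E \<in> events"
  shows "(LINT \<omega>:E|M. (Y \<omega> - c)\<^sup>2) = risk M Y E + prob E * (cond_mean M Y E - c)\<^sup>2"
proof -
  define m where "m = cond_mean M Y E"
  have mean: "(LINT \<omega>:E|M. Y \<omega>) = prob E * m"
  proof (cases "prob E = 0")
    case True
    then have "AE \<omega> in M. \<omega> \<notin> E"
      using E by (simp add: prob_eq_0)
    then have "AE \<omega> in M. indicator E \<omega> *\<^sub>R Y \<omega> = 0"
      by eventually_elim simp
    then have "(LINT \<omega>:E|M. Y \<omega>) = 0"
      unfolding set_lebesgue_integral_def by (rule integral_eq_zero_AE)
    with True show ?thesis by simp
  next
    case False
    then show ?thesis
      using E by (simp add: m_def cond_mean_def integral_uniform_measure)
  qed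
  have i1: "set_integrable M E Y" and i2: "set_integrable M E (\<lambda>\<omega>. (Y \<omega> - m)\<^sup>2)"
    and i3: "\<And>r::real. set_integrable M E (\<lambda>\<omega>. r)"
    using E integrable_Y integrable_dev by (auto intro: set_integrable_of_integrable)
  have const: "(LINT \<omega>:E|M. r) = prob E * r" for r :: real
    using E unfolding set_lebesgue_integral_def by simp
  have "(LINT \<omega>:E|M. (Y \<omega> - c)\<^sup>2)
      = (LINT \<omega>:E|M. ((Y \<omega> - m)\<^sup>2 + (2 * (m - c)) * Y \<omega>) + (c\<^sup>2 - m\<^sup>2))"
    by (intro set_lebesgue_integral_cong E) (auto simp: power2_eq_square algebra_simps)
  also have "\<dots> = (LINT \<omega>:E|M. (Y \<omega> - m)\<^sup>2) + (2 * (m - c)) * (LINT \<omega>:E|M. Y \<omega>)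
      + (LINT \<omega>:E|M. c\<^sup>2 - m\<^sup>2)"
    using i1 i2 i3 by (subst set_integral_add set_integrable_mult_right set_integral_mult_right; simp)+
  also have "\<dots> = risk M Y E + prob E * (m - c)\<^sup>2"
    unfolding mean const m_def[symmetric] risk_eq_dev[OF E]
    by (simp add: power2_eq_square algebra_simps)
  finally show ?thesis
    by (simp add: m_def)
qed

lemma risk_le_dev:
  "E \<in> events \<Longrightarrow> risk M Y E \<le> (LINT \<omega>:E|M. (Y \<omega> - c)\<^sup>2)"
  by (simp add: dev_eq_risk)

lemma dev_Un:
  assumes "E \<in> events" "F \<in> events" "E \<inter> F = {}"
  shows "(LINT \<omega>:E \<union> F|M. (Y \<omega> - c)\<^sup>2)
    = (LINT \<omega>:E|M. (Y \<omega> - c)\<^sup>2) + (LINT \<omega>:F|M. (Y \<omega> - c)\<^sup>2)"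
  using assms by (intro set_integral_Un set_integrable_of_integrable integrable_dev)

lemma risk_nonneg: "risk M Y E \<ge> 0"
  by (auto simp: risk_def cond_var_def)

text \<open>One centre serves both parts: the conditional mean of the union competes with the
  optimal centre of each event.\<close>

lemma risk_superadditive:
  assumes "E \<in> events" "F \<in> events" "E \<inter> F = {}"
  shows "risk M Y E + risk M Y F \<le> risk M Y (E \<union> F)"
  using risk_le_dev[OF assms(1), of "cond_mean M Y (E \<union> F)"]
    risk_le_dev[OF assms(2), of "cond_mean M Y (E \<union> F)"] dev_Un[OF assms, of "cond_mean M Y (E \<union> F)"]
    risk_eq_dev[OF sets.Un[OF assms(1,2)]] by linarith

text \<open>Each risk is at most the deviation about the other event's mean, and deviations about a
  common centre agree.\<close>

lemma risk_cong_AE: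
  assumes "E \<in> events" "F \<in> events" "AE \<omega> in M. \<omega> \<in> E \<longleftrightarrow> \<omega> \<in> F"
  shows "risk M Y E = risk M Y F"
proof -
  have "prob E = prob F"
    using assms by (intro finite_measure_eq_AE) auto
  moreover have "(LINT \<omega>:E|M. (Y \<omega> - c)\<^sup>2) = (LINT \<omega>:F|M. (Y \<omega> - c)\<^sup>2)" for c
    using assms by (intro set_integral_cong_set) (auto simp: set_borel_measurable_def)
  ultimately show ?thesis
    using risk_le_dev[OF assms(1), of "cond_mean M Y F"] risk_le_dev[OF assms(2), of "cond_mean M Y E"]
    by (simp add: risk_eq_dev[OF assms(1)] risk_eq_dev[OF assms(2)])
qed

end

section \<open>Almost surely bounded responses\<close>

locale bounded_rv = square_integrable_rv +
  fixes lo hi :: real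
  assumes AE_bounds: "AE \<omega> in M. lo \<le> Y \<omega> \<and> Y \<omega> \<le> hi"
begin

lemma lo_le_hi: "lo \<le> hi"
proof -
  have "AE \<omega> in M. lo \<le> hi"
    using AE_bounds by eventually_elim simp
  then show ?thesis by simp
qed

lemma cond_mean_bounds:
  assumes E: "E \<in> events" and "prob E \<noteq> 0"
  shows "lo \<le> cond_mean M Y E" and "cond_mean M Y E \<le> hi"
proof -
  have pos: "prob E > 0"
    using assms(2) by (simp add: zero_less_measure_iff)
  have const: "(LINT \<omega>:E|M. r) = prob E * r" for r :: real
    using E unfolding set_lebesgue_integral_def by simp
  have int: "set_integrable M E f" if "integrable M f" for f :: "'a \<Rightarrow> real"
    using E that by (rule set_integrable_of_integrable)
  have "(LINT \<omega>:E|M. lo) \<le> (LINT \<omega>:E|M. Y \<omega>)"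
    using AE_bounds by (intro set_integral_mono_AE int integrable_Y) auto
  moreover have "(LINT \<omega>:E|M. Y \<omega>) \<le> (LINT \<omega>:E|M. hi)"
    using AE_bounds by (intro set_integral_mono_AE int integrable_Y) auto
  ultimately show "lo \<le> cond_mean M Y E" "cond_mean M Y E \<le> hi"
    using pos assms unfolding const cond_mean_def
    by (simp_all add: integral_uniform_measure field_simps)
qed

text \<open>Centring at the mean of \<open>B\<close> costs nothing extra on \<open>B\<close>. Since
  that centre lies between \<open>lo\<close> and \<open>hi\<close>, it costs at most
  \<open>(hi - lo)\<^sup>2\<close> per unit of mass on \<open>C\<close>.\<close>

lemma risk_Un_le:
  assumes B: "B \<in> events" and C: "C \<in> events" and "B \<inter> C = {}"
  shows "risk M Y (B \<union> C) \<le> risk M Y B + prob C * (hi - lo)\<^sup>2"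
proof -
  \<comment> \<open>On a null \<open>B\<close> the conditional mean is 0 by convention and may lie
    outside the bounds. Every centre has zero deviation there, so \<open>lo\<close> is
    taken.\<close>
  define c where "c = (if prob B = 0 then lo else cond_mean M Y B)"
  have c: "lo \<le> c" "c \<le> hi"
    using cond_mean_bounds[OF B] lo_le_hi by (auto simp: c_def)
  have "risk M Y (B \<union> C) \<le> (LINT \<omega>:B \<union> C|M. (Y \<omega> - c)\<^sup>2)"
    using B C by (intro risk_le_dev) auto
  also have "\<dots> = (LINT \<omega>:B|M. (Y \<omega> - c)\<^sup>2) + (LINT \<omega>:C|M. (Y \<omega> - c)\<^sup>2)"
    by (rule dev_Un) fact+
  also have "(LINT \<omega>:B|M. (Y \<omega> - c)\<^sup>2) = risk M Y B"
    by (simp add: dev_eq_risk[OF B] c_def)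
  also have "(LINT \<omega>:C|M. (Y \<omega> - c)\<^sup>2) \<le> (LINT \<omega>:C|M. (hi - lo)\<^sup>2)"
  proof (rule set_integral_mono_AE)
    show "AE \<omega>\<in>C in M. (Y \<omega> - c)\<^sup>2 \<le> (hi - lo)\<^sup>2"
      using AE_bounds
    proof eventually_elim
      case (elim \<omega>)
      then have "\<bar>Y \<omega> - c\<bar> \<le> \<bar>hi - lo\<bar>"
        using c by linarith
      then show ?case
        by (simp add: abs_le_square_iff)
    qed
  qed (use C integrable_dev in \<open>auto intro: set_integrable_of_integrable\<close>)
  also have "(LINT \<omega>:C|M. (hi - lo)\<^sup>2) = prob C * (hi - lo)\<^sup>2"
    using C unfolding set_lebesgue_integral_def by simp
  finally show ?thesis by simp
qed

lemma risk_le_prob: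
  assumes "C \<in> events"
  shows "risk M Y C \<le> prob C * (hi - lo)\<^sup>2"
  using risk_Un_le[of "{}" C] assms by (simp add: risk_def)

end

section \<open>Variation functions\<close>

text \<open>Only the last point is compared with \<open>x\<close>: as \<open>t\<close> is monotone,
  all points used then lie in the ray up to \<open>x\<close>.\<close>

definition variation_sums :: "(real \<Rightarrow> real) \<Rightarrow> real \<Rightarrow> real set" where
  "variation_sums h x =
     {(\<Sum>i<n. \<bar>h (t (Suc i)) - h (t i)\<bar>) | (n::nat) (t::nat \<Rightarrow> real). mono t \<and> t n \<le> x}"

text \<open>The variation function of \<open>h\<close>, that is, its total variation over the ray up
  to \<open>x\<close>.\<close>

definition variation_upto :: "(real \<Rightarrow> real) \<Rightarrow> real \<Rightarrow> real" where
  "variation_upto h x = Sup (variation_sums h x)"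

lemma total_variation_nonneg: "0 \<le> total_variation h"
proof -
  have "ereal (\<Sum>i<(0::nat). \<bar>h ((\<lambda>_. 0) (Suc i)) - h ((\<lambda>_. 0) i)\<bar>) \<le> total_variation h"
    unfolding total_variation_def
    by (intro Sup_upper CollectI exI conjI) (auto simp: mono_def)
  then show ?thesis by (simp add: zero_ereal_def)
qed

context
  fixes h :: "real \<Rightarrow> real"
  assumes BV: "total_variation h < \<infinity>"
begin

lemma ereal_total_variation: "ereal (real_of_ereal (total_variation h)) = total_variation h"
  using BV total_variation_nonneg[of h] by (intro ereal_real') auto

lemma variation_sums_le:
  assumes "s \<in> variation_sums h x"
  shows "s \<le> real_of_ereal (total_variation h)"
proof -
  have "ereal s \<le> total_variation h"
    using assms unfolding total_variation_def variation_sums_def by (intro Sup_upper) auto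
  then show ?thesis
    using ereal_total_variation by (metis ereal_less_eq(3))
qed

lemma bdd_above_variation_sums: "bdd_above (variation_sums h x)"
  using variation_sums_le by (rule bdd_aboveI)

lemma zero_in_variation_sums: "0 \<in> variation_sums h x"
  unfolding variation_sums_def
  by (intro CollectI exI[of _ "0::nat"] exI[of _ "\<lambda>_. x"]) (auto simp: mono_def)

lemma variation_upto_bounds:
  shows "0 \<le> variation_upto h x"
    and "variation_upto h x \<le> real_of_ereal (total_variation h)"
  unfolding variation_upto_def
  using bdd_above_variation_sums zero_in_variation_sums[of x] variation_sums_le[of _ x]
  by (auto intro!: cSup_upper cSup_least)

text \<open>A chain ending at or before \<open>x\<close> is prolonged by the points \<open>x\<close>
  and \<open>y\<close>, which raises its sum by at least
  \<open>\<bar>h y - h x\<bar>\<close>.\<close>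

lemma variation_upto_add:
  assumes "x \<le> y"
  shows "variation_upto h x + \<bar>h y - h x\<bar> \<le> variation_upto h y"
proof -
  have "s \<le> variation_upto h y - \<bar>h y - h x\<bar>" if "s \<in> variation_sums h x" for s
  proof -
    obtain n t where s: "s = (\<Sum>i<n. \<bar>h (t (Suc i)) - h (t i)\<bar>)"
      and t: "mono t" "t n \<le> x"
      using \<open>s \<in> variation_sums h x\<close> unfolding variation_sums_def by auto
    \<comment> \<open>Constant from index \<open>n + 2\<close> on, since a chain has to be monotone
      on all natural numbers.\<close>
    define u where "u i = (if i \<le> n then t i else if i = Suc n then x else y)" for i
    have "t i \<le> x" if "i \<le> n" for i
      using t that by (meson monoD order.trans)
    then have "mono u"
      using t assms unfolding u_def mono_def by (auto intro: order.trans)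
    then have mem: "(\<Sum>i<n + 2. \<bar>h (u (Suc i)) - h (u i)\<bar>) \<in> variation_sums h y"
      unfolding variation_sums_def
      by (intro CollectI exI[of _ "n + 2"] exI[of _ u]) (simp add: u_def)
    have "(\<Sum>i<n + 2. \<bar>h (u (Suc i)) - h (u i)\<bar>)
        = (\<Sum>i<n. \<bar>h (u (Suc i)) - h (u i)\<bar>) + \<bar>h x - h (t n)\<bar> + \<bar>h y - h x\<bar>"
      by (simp add: u_def)
    also have "(\<Sum>i<n. \<bar>h (u (Suc i)) - h (u i)\<bar>) = s"
      unfolding s by (intro sum.cong) (auto simp: u_def)
    finally have "s + \<bar>h x - h (t n)\<bar> + \<bar>h y - h x\<bar> \<le> variation_upto h y"
      using cSup_upper[OF mem bdd_above_variation_sums] by (simp add: variation_upto_def)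
    then show ?thesis by linarith
  qed
  then have "variation_upto h x \<le> variation_upto h y - \<bar>h y - h x\<bar>"
    unfolding variation_upto_def[of h x] using zero_in_variation_sums by (intro cSup_least) auto
  then show ?thesis by linarith
qed

lemma mono_variation_upto: "mono (variation_upto h)"
proof (rule monoI)
  fix x y :: real assume "x \<le> y"
  then show "variation_upto h x \<le> variation_upto h y"
    using variation_upto_add[of x y] by linarith
qed

lemma abs_diff_le_variation_upto:
  "\<bar>h x - h y\<bar> \<le> \<bar>variation_upto h x - variation_upto h y\<bar>"
  using variation_upto_add[of x y] variation_upto_add[of y x] by linarith

text \<open>Jordan decomposition: the variation function and its difference with \<open>h\<close>
  are both monotone.\<close>

lemma BV_borel_measurable: "h \<in> borel_measurable borel"
proof -
  have "mono (\<lambda>x. variation_upto h x - h x)"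
  proof (rule monoI)
    fix x y :: real assume "x \<le> y"
    then show "variation_upto h x - h x \<le> variation_upto h y - h y"
      using variation_upto_add[of x y] by linarith
  qed
  then have "(\<lambda>x. variation_upto h x - (variation_upto h x - h x)) \<in> borel_measurable borel"
    using mono_variation_upto by (intro borel_measurable_diff borel_measurable_mono)
  then show ?thesis by simp
qed

lemma diameter_variation_upto_le:
  "diameter (variation_upto h ` S) \<le> real_of_ereal (total_variation h)"
proof (rule diameter_le)
  show "variation_upto h ` S \<noteq> {} \<or> 0 \<le> real_of_ereal (total_variation h)"
    using total_variation_nonneg[of h] by (simp add: real_of_ereal_pos)
next
  fix a b assume "a \<in> variation_upto h ` S" "b \<in> variation_upto h ` S"
  then obtain x y where ab: "a = variation_upto h x" "b = variation_upto h y" by auto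
  show "norm (a - b) \<le> real_of_ereal (total_variation h)"
    using variation_upto_bounds[of x] variation_upto_bounds[of y]
    unfolding ab real_norm_def by linarith
qed

lemma bounded_variation_upto: "bounded (variation_upto h ` S)"
  using variation_upto_bounds
  by (intro boundedI[where B = "real_of_ereal (total_variation h)"]) auto

end

section \<open>Diameters and midpoints of sets of reals\<close>

text \<open>With \<open>S\<close> to the left of \<open>T\<close>, a distance in \<open>S\<close>
  and a distance in \<open>T\<close> fit side by side between the outermost of the four
  points.\<close>

lemma diameter_split_le:
  fixes S T :: "real set"
  assumes "bounded (S \<union> T)" and "\<And>x y. x \<in> S \<Longrightarrow> y \<in> T \<Longrightarrow> x \<le> y"
  shows "diameter S + diameter T \<le> diameter (S \<union> T)"
proof (cases "S = {} \<or> T = {}")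
  case True
  then show ?thesis by auto
next
  case False
  have "\<bar>x - x'\<bar> + \<bar>y - y'\<bar> \<le> diameter (S \<union> T)"
    if S: "x \<in> S" "x' \<in> S" and T: "y \<in> T" "y' \<in> T" for x x' y y'
  proof -
    have "\<bar>a - b\<bar> \<le> diameter (S \<union> T)" if "a \<in> S" "b \<in> T" for a b
      using diameter_bounded_bound[OF assms(1), of a b] that by (auto simp: dist_real_def)
    from this[OF S(1) T(1)] this[OF S(1) T(2)] this[OF S(2) T(1)] this[OF S(2) T(2)]
    show ?thesis
      using assms(2)[OF S(1) T(1)] assms(2)[OF S(1) T(2)] assms(2)[OF S(2) T(1)]
        assms(2)[OF S(2) T(2)]
      by linarith
  qed
  \<comment> \<open>The two suprema are taken one after the other, first over \<open>T\<close>, then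
    over \<open>S\<close>.\<close>
  then have "diameter T \<le> diameter (S \<union> T) - \<bar>x - x'\<bar>" if "x \<in> S" "x' \<in> S" for x x'
    using that False by (intro diameter_le) (force simp: algebra_simps)+
  then have "diameter S \<le> diameter (S \<union> T) - diameter T"
    using False by (intro diameter_le) (force simp: algebra_simps)+
  then show ?thesis by simp
qed

text \<open>For nonempty \<open>A\<close> the centre is the supremum minus \<open>D / 2\<close>.
  Halving the oscillation yields the factor 1/4 after squaring.\<close>

lemma ex_midpoint:
  fixes f :: "'b \<Rightarrow> real"
  assumes "\<And>x y. x \<in> A \<Longrightarrow> y \<in> A \<Longrightarrow> \<bar>f x - f y\<bar> \<le> D"
  shows "\<exists>c. \<forall>x\<in>A. \<bar>f x - c\<bar> \<le> D / 2"
proof (cases "A = {}")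
  case False
  then obtain z where z: "z \<in> A" by auto
  have "bdd_above (f ` A)"
    using assms[OF _ z] by (intro bdd_aboveI2[where M = "f z + D"]) (smt (verit))
  have "Sup (f ` A) \<le> f y + D" if "y \<in> A" for y
    using assms[OF _ that] False by (intro cSUP_least) (smt (verit))+
  moreover have "f x \<le> Sup (f ` A)" if "x \<in> A" for x
    using that \<open>bdd_above (f ` A)\<close> by (rule cSUP_upper)
  ultimately have "\<forall>x\<in>A. \<bar>f x - (Sup (f ` A) - D / 2)\<bar> \<le> D / 2"
    by (smt (verit) field_sum_of_halves)
  then show ?thesis by blast
qed auto

section \<open>One minimax split\<close>

declare One_nat_def [simp del]

text \<open>\<open>F\<close> is a finite set carrying the law of \<open>X\<close>; it leaves
  finitely many coordinate values to consider as thresholds.\<close>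

locale regression_setting = bounded_rv M Y lo hi for M :: "'a measure" and Y lo hi +
  fixes d :: nat and X :: "'a \<Rightarrow> nat \<Rightarrow> real" and N :: real and F :: "(nat \<Rightarrow> real) set"
  assumes d_pos: "d \<ge> 1"
    and X_measurable [measurable]: "X \<in> M \<rightarrow>\<^sub>M borel_Rd d"
    and N_pos: "N > 0"
    and atom_le: "\<And>j u. j \<in> {1..d} \<Longrightarrow> prob {\<omega> \<in> space M. X \<omega> j = u} \<le> 1 / N"
    and finite_F: "finite F"
    and AE_X_in_F: "AE \<omega> in M. X \<omega> \<in> F"
begin

abbreviation cell :: "(nat \<Rightarrow> real) set \<Rightarrow> 'a set" where
  "cell A \<equiv> cell_event M X A"

lemma cell_measurable [measurable, simp]:
  "A \<in> sets (borel_Rd d) \<Longrightarrow> cell A \<in> events"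
  using measurable_sets[OF X_measurable, of A]
  by (simp add: cell_event_def vimage_def Int_def conj_commute)

lemma halfspace_measurable:
  assumes j: "j \<in> {1..d}" and A: "A \<in> sets (borel_Rd d)"
  shows "{x \<in> A. x j < s} \<in> sets (borel_Rd d)" "{x \<in> A. x j \<ge> s} \<in> sets (borel_Rd d)"
    "{x \<in> A. x j > s} \<in> sets (borel_Rd d)" "{x \<in> A. x j = s} \<in> sets (borel_Rd d)"
proof -
  have [measurable]: "(\<lambda>x. x j) \<in> borel_Rd d \<rightarrow>\<^sub>M (borel :: real measure)"
    using j by (rule measurable_component_singleton)
  have "{x \<in> space (borel_Rd d). x j < s} \<in> sets (borel_Rd d)"
    "{x \<in> space (borel_Rd d). x j \<ge> s} \<in> sets (borel_Rd d)"
    "{x \<in> space (borel_Rd d). x j > s} \<in> sets (borel_Rd d)"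
    "{x \<in> space (borel_Rd d). x j = s} \<in> sets (borel_Rd d)"
    by measurable
  then have "A \<inter> {x \<in> space (borel_Rd d). x j < s} \<in> sets (borel_Rd d)"
    "A \<inter> {x \<in> space (borel_Rd d). x j \<ge> s} \<in> sets (borel_Rd d)"
    "A \<inter> {x \<in> space (borel_Rd d). x j > s} \<in> sets (borel_Rd d)"
    "A \<inter> {x \<in> space (borel_Rd d). x j = s} \<in> sets (borel_Rd d)"
    using A by blast+
  moreover have "A \<inter> {x \<in> space (borel_Rd d). P x} = {x \<in> A. P x}" for P
    using sets.sets_into_space[OF A] by blast
  ultimately show "{x \<in> A. x j < s} \<in> sets (borel_Rd d)" "{x \<in> A. x j \<ge> s} \<in> sets (borel_Rd d)"
    "{x \<in> A. x j > s} \<in> sets (borel_Rd d)" "{x \<in> A. x j = s} \<in> sets (borel_Rd d)"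
    by simp_all
qed

lemma cell_disjoint: "A \<inter> B = {} \<Longrightarrow> cell A \<inter> cell B = {}"
  by (auto simp: cell_event_def)

text \<open>There is no mass outside \<open>F\<close>, so a cell may be replaced by any measurable
  set containing the same points of \<open>F\<close>.\<close>

lemma risk_cell_cong:
  assumes "A \<in> sets (borel_Rd d)" "B \<in> sets (borel_Rd d)" "A \<inter> F = B \<inter> F"
  shows "risk M Y (cell A) = risk M Y (cell B)"
proof (rule risk_cong_AE)
  show "AE \<omega> in M. \<omega> \<in> cell A \<longleftrightarrow> \<omega> \<in> cell B"
    using AE_X_in_F by eventually_elim (use assms(3) in \<open>auto simp: cell_event_def\<close>)
qed (use assms in auto)

lemma risk_cell_split:
  assumes j: "j \<in> {1..d}" and A: "A \<in> sets (borel_Rd d)"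
  shows "risk M Y (cell {x \<in> A. x j < s}) + risk M Y (cell {x \<in> A. x j \<ge> s}) \<le> risk M Y (cell A)"
proof -
  have "cell A = cell {x \<in> A. x j < s} \<union> cell {x \<in> A. x j \<ge> s}"
    by (auto simp: cell_event_def)
  moreover have "cell {x \<in> A. x j < s} \<inter> cell {x \<in> A. x j \<ge> s} = {}"
    by (rule cell_disjoint) auto
  ultimately show ?thesis
    using risk_superadditive halfspace_measurable[OF j A] by simp
qed

text \<open>The threshold \<open>t\<close> is the largest coordinate of a point of \<open>F\<close>
  in \<open>A\<close> such that the part to its left has at most half of the risk. The part strictly
  to the right then also has at most half, and the slice at \<open>t\<close> adds at most
  \<open>(hi - lo)\<^sup>2 / N\<close>. Being a coordinate of a point of \<open>A\<close>, the
  threshold is admissible for the algorithm.\<close>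

lemma ex_balanced_split:
  assumes j: "j \<in> {1..d}" and A: "A \<in> sets (borel_Rd d)" and pos: "prob (cell A) > 0"
  shows "\<exists>z\<in>A. minimax_objective M X Y A j (z j) \<le> risk M Y (cell A) / 2 + (hi - lo)\<^sup>2 / N"
proof -
  define U where "U = (\<lambda>x. x j) ` (F \<inter> A)"
  define G where "G = {u \<in> U. risk M Y (cell {x \<in> A. x j < u}) \<le> risk M Y (cell A) / 2}"
  note hm = halfspace_measurable[OF j A]
  have empty: "risk M Y (cell {}) = 0"
    by (simp add: cell_event_def risk_def)
  have "finite U"
    using finite_F by (simp add: U_def)
  then have "finite G"
    by (simp add: G_def)
  have "F \<inter> A \<noteq> {}"
  proof
    assume "F \<inter> A = {}"
    then have "AE \<omega> in M. \<omega> \<notin> cell A"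
      using AE_X_in_F by (auto simp: cell_event_def elim!: eventually_mono)
    then have "prob (cell A) = 0"
      using A prob_eq_0 by simp
    then show False
      using pos by simp
  qed
  then have "U \<noteq> {}"
    by (simp add: U_def)
  \<comment> \<open>No point of \<open>F\<close> in \<open>A\<close> lies to the left of the least
    coordinate, so \<open>G\<close> is nonempty.\<close>
  have "Min U \<in> G"
  proof -
    have "Min U \<le> x j" if "x \<in> F" "x \<in> A" for x
      using \<open>finite U\<close> that by (intro Min_le) (auto simp: U_def)
    then have "risk M Y (cell {x \<in> A. x j < Min U}) = risk M Y (cell {})"
      by (intro risk_cell_cong hm) (auto simp: not_less[symmetric])
    then show ?thesis
      using \<open>finite U\<close> \<open>U \<noteq> {}\<close> risk_nonneg empty by (simp add: G_def)
  qed
  define t where "t = Max G"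
  have "t \<in> G"
    unfolding t_def using \<open>finite G\<close> \<open>Min U \<in> G\<close> by (intro Max_in) auto
  have right: "risk M Y (cell {x \<in> A. x j > t}) \<le> risk M Y (cell A) / 2"
  proof (cases "\<exists>u\<in>U. u > t")
    case False
    then have "risk M Y (cell {x \<in> A. x j > t}) = risk M Y (cell {})"
      by (intro risk_cell_cong hm) (auto simp: U_def)
    then show ?thesis
      using empty risk_nonneg by simp
  next
    case True
    \<comment> \<open>The next coordinate after \<open>t\<close>. By maximality of \<open>t\<close>,
      the part left of \<open>u\<close> has more than half of the risk; superadditivity leaves less
      than half for the rest, which contains the same points of \<open>F\<close> as the part right
      of \<open>t\<close>.\<close>
    define u where "u = Min {u \<in> U. u > t}"
    have "u \<in> {u \<in> U. u > t}"
      unfolding u_def using True \<open>finite U\<close> by (intro Min_in) auto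
    then have u: "u \<in> U" "u > t" "\<And>u'. u' \<in> U \<Longrightarrow> u' > t \<Longrightarrow> u \<le> u'"
      using \<open>finite U\<close> by (auto simp: u_def)
    then have "u \<notin> G"
      using Max_ge[OF \<open>finite G\<close>, of u] by (auto simp: t_def)
    then have "risk M Y (cell {x \<in> A. x j < u}) > risk M Y (cell A) / 2"
      using u by (simp add: G_def)
    moreover have "risk M Y (cell {x \<in> A. x j > t}) = risk M Y (cell {x \<in> A. x j \<ge> u})"
      using u by (intro risk_cell_cong hm) (force simp: U_def)
    ultimately show ?thesis
      using risk_cell_split[OF j A, of u] by simp
  qed
  have "cell {x \<in> A. x j \<ge> t} = cell {x \<in> A. x j > t} \<union> cell {x \<in> A. x j = t}"
    by (auto simp: cell_event_def)
  then have "risk M Y (cell {x \<in> A. x j \<ge> t})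
      \<le> risk M Y (cell {x \<in> A. x j > t}) + prob (cell {x \<in> A. x j = t}) * (hi - lo)\<^sup>2"
    using hm by (simp, intro risk_Un_le cell_disjoint) auto
  also have "prob (cell {x \<in> A. x j = t}) \<le> prob {\<omega> \<in> space M. X \<omega> j = t}"
  proof (rule finite_measure_mono)
    show "{\<omega> \<in> space M. X \<omega> j = t} \<in> events"
      using measurable_compose[OF X_measurable measurable_component_singleton[OF j]] by measurable
  qed (auto simp: cell_event_def)
  also have "\<dots> \<le> 1 / N"
    by (rule atom_le[OF j])
  finally have "risk M Y (cell {x \<in> A. x j \<ge> t}) \<le> risk M Y (cell A) / 2 + (hi - lo)\<^sup>2 / N"
    using right by (simp add: mult_right_mono)
  moreover have "risk M Y (cell {x \<in> A. x j < t}) \<le> risk M Y (cell A) / 2 + (hi - lo)\<^sup>2 / N"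
    using \<open>t \<in> G\<close> N_pos by (simp add: G_def add_increasing2)
  ultimately have "minimax_objective M X Y A j t \<le> risk M Y (cell A) / 2 + (hi - lo)\<^sup>2 / N"
    by (simp add: minimax_objective_def risk_def Let_def)
  moreover obtain z where "z \<in> A" "t = z j"
    using \<open>t \<in> G\<close> by (auto simp: G_def U_def)
  ultimately show ?thesis by auto
qed

text \<open>The minimiser is compared with the balanced threshold \<open>z j\<close>. As
  \<open>z\<close> is in \<open>A\<close>, this value lies in the \<open>j\<close>-th side for
  whichever representation of \<open>A\<close> as a box is used.\<close>

lemma minimax_split_risk:
  assumes j: "j \<in> {1..d}" and A: "A \<in> sets (borel_Rd d)"
    and spl: "\<not> unsplittable M d X Y A" and thr: "minimax_threshold M d X Y A j s"
  shows "risk M Y (cell {x \<in> A. x j < s}) \<le> risk M Y (cell A) / 2 + (hi - lo)\<^sup>2 / N"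
    and "risk M Y (cell {x \<in> A. x j \<ge> s}) \<le> risk M Y (cell A) / 2 + (hi - lo)\<^sup>2 / N"
proof -
  have "prob (cell A) > 0"
    using spl by (auto simp: unsplittable_def Let_def zero_less_measure_iff)
  then obtain z where z: "z \<in> A"
    "minimax_objective M X Y A j (z j) \<le> risk M Y (cell A) / 2 + (hi - lo)\<^sup>2 / N"
    using ex_balanced_split[OF j A] by blast
  obtain a b where "A = box_Rd d a b"
    and s: "is_arg_min (minimax_objective M X Y A j) (\<lambda>t. a j \<le> ereal t \<and> ereal t < b j) s"
    using thr by (auto simp: minimax_threshold_def)
  then have "a j \<le> ereal (z j) \<and> ereal (z j) < b j"
    using z j by (auto simp: box_Rd_def)
  then have "minimax_objective M X Y A j s \<le> minimax_objective M X Y A j (z j)"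
    using s by (auto simp: is_arg_min_linorder)
  then have "minimax_objective M X Y A j s \<le> risk M Y (cell A) / 2 + (hi - lo)\<^sup>2 / N"
    using z(2) by linarith
  then show "risk M Y (cell {x \<in> A. x j < s}) \<le> risk M Y (cell A) / 2 + (hi - lo)\<^sup>2 / N"
    and "risk M Y (cell {x \<in> A. x j \<ge> s}) \<le> risk M Y (cell A) / 2 + (hi - lo)\<^sup>2 / N"
    by (simp_all add: minimax_objective_def risk_def Let_def)
qed

text \<open>Such cells are kept for ever, so their bound cannot come from halving. The risk is 0 if
  the cell is null or \<open>Y\<close> is almost surely constant on it. If \<open>X\<close> is, the
  mass of the cell is at most that of one value of the first coordinate.\<close>

lemma unsplittable_risk:
  assumes A: "A \<in> sets (borel_Rd d)" and uns: "unsplittable M d X Y A"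
  shows "risk M Y (cell A) \<le> (hi - lo)\<^sup>2 / N"
proof -
  define E where "E = cell A"
  have E [measurable]: "E \<in> events"
    using A by (simp add: E_def)
  have nonneg: "0 \<le> (hi - lo)\<^sup>2 / N"
    using N_pos by simp
  consider "prob E = 0"
    | c where "prob E > 0" "distr (uniform_measure M E) borel Y = return borel c"
    | c where "prob E > 0" "distr (uniform_measure M E) (borel_Rd d) X = return (borel_Rd d) c"
        "c \<in> Rd d"
    using uns unfolding unsplittable_def Let_def E_def by blast
  then have "risk M Y E \<le> (hi - lo)\<^sup>2 / N"
  proof cases
    case 1
    then show ?thesis
      using nonneg by (simp add: risk_def)
  next
    case 2
    have int: "(\<integral>\<omega>. f (Y \<omega>) \<partial>uniform_measure M E) = f c"
      if f: "f \<in> borel_measurable borel" for f :: "real \<Rightarrow> real"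
    proof -
      have "(\<integral>\<omega>. f (Y \<omega>) \<partial>uniform_measure M E) = (\<integral>y. f y \<partial>distr (uniform_measure M E) borel Y)"
        using f by (subst integral_distr) auto
      also have "\<dots> = f c"
        unfolding 2 using f by (simp add: integral_return)
      finally show ?thesis .
    qed
    have "cond_mean M Y E = c"
      using int[of "\<lambda>y. y"] by (simp add: cond_mean_def)
    then have "cond_var M Y E = 0"
      using int[of "\<lambda>y. (y - c)\<^sup>2"] by (simp add: cond_var_def)
    then show ?thesis
      using nonneg by (simp add: risk_def)
  next
    case 3
    \<comment> \<open>Null under the point mass at \<open>c\<close>; coordinate 1 exists because
      \<open>d\<close> is positive.\<close>
    define B where "B = {x \<in> space (borel_Rd d). x 1 \<noteq> c 1}"
    have comp [measurable]: "(\<lambda>x. x 1) \<in> borel_Rd d \<rightarrow>\<^sub>M (borel :: real measure)"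
      using d_pos by (intro measurable_component_singleton) auto
    have B [measurable]: "B \<in> sets (borel_Rd d)"
      unfolding B_def by measurable
    have "emeasure (uniform_measure M E) (X -` B \<inter> space M) = emeasure (return (borel_Rd d) c) B"
      unfolding 3(2)[symmetric] by (subst emeasure_distr) (auto simp: B measurable_def[of M] intro: X_measurable)
    also have "\<dots> = 0"
      by (simp add: B_def)
    finally have "emeasure M (E \<inter> (X -` B \<inter> space M)) = 0"
      using \<open>prob E > 0\<close> by (simp add: ennreal_divide_eq_0_iff emeasure_eq_measure)
    then have null: "AE \<omega> in M. \<omega> \<notin> E \<inter> (X -` B \<inter> space M)"
      by (intro AE_not_in) (auto simp: null_sets_def)
    have "prob E \<le> prob {\<omega> \<in> space M. X \<omega> 1 = c 1}"
    proof (rule finite_measure_mono_AE)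
      show "{\<omega> \<in> space M. X \<omega> 1 = c 1} \<in> events"
        using measurable_compose[OF X_measurable comp] by measurable
      show "AE \<omega> in M. \<omega> \<in> E \<longrightarrow> \<omega> \<in> {\<omega> \<in> space M. X \<omega> 1 = c 1}"
        using null AE_space
      proof eventually_elim
        case (elim \<omega>)
        then show ?case
          using measurable_space[OF X_measurable] by (auto simp: B_def)
      qed
    qed
    also have "\<dots> \<le> 1 / N"
      using d_pos by (intro atom_le) auto
    finally have "prob E * (hi - lo)\<^sup>2 \<le> 1 / N * (hi - lo)\<^sup>2"
      by (rule mult_right_mono) simp
    then show ?thesis
      using risk_le_prob[OF E] by simp
  qed
  then show ?thesis
    by (simp add: E_def)
qed

end

declare One_nat_def [simp]

section \<open>Interpolation inequalities\<close>

lemma Young_two_thirds: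
  fixes x y :: real
  assumes "0 \<le> x" "0 \<le> y"
  shows "x powr (2/3) * y powr (1/3) \<le> 2/3 * x + 1/3 * y"
proof (cases "x = 0 \<or> y = 0")
  case False
  then show ?thesis
    using Youngs_inequality_0[of "2/3" "1/3" x y] assms by simp
qed (use assms in auto)

text \<open>Hoelder's inequality with exponents 3/2 and 3. Dividing \<open>D\<close> by its sum
  reduces it to Young's inequality term by term, where the weights 2/3 and 1/3 add up to 1.\<close>

lemma Hoelder_two_thirds:
  fixes p D :: "'i \<Rightarrow> real"
  assumes "finite I" and p: "\<And>i. i \<in> I \<Longrightarrow> 0 \<le> p i" and D: "\<And>i. i \<in> I \<Longrightarrow> 0 \<le> D i"
    and "sum p I \<le> 1"
  shows "(\<Sum>i\<in>I. D i powr (2/3) * p i powr (1/3)) \<le> sum D I powr (2/3)"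
proof (cases "sum D I = 0")
  case True
  then have "\<And>i. i \<in> I \<Longrightarrow> D i = 0"
    using assms by (simp add: sum_nonneg_eq_0_iff)
  then show ?thesis by simp
next
  case False
  define S where "S = sum D I"
  have S: "S > 0"
    using False sum_nonneg[of I D] D by (fastforce simp: S_def)
  have "(\<Sum>i\<in>I. D i powr (2/3) * p i powr (1/3))
      = S powr (2/3) * (\<Sum>i\<in>I. (D i / S) powr (2/3) * p i powr (1/3))"
    unfolding sum_distrib_left using S D
    by (intro sum.cong) (auto simp: powr_divide)
  also have "(\<Sum>i\<in>I. (D i / S) powr (2/3) * p i powr (1/3))
      \<le> (\<Sum>i\<in>I. 2/3 * (D i / S) + 1/3 * p i)"
    using S D p by (intro sum_mono Young_two_thirds) auto
  also have "\<dots> = 2/3 * (sum D I / S) + 1/3 * sum p I"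
    by (simp add: sum.distrib sum_distrib_left sum_divide_distrib)
  also have "\<dots> \<le> 1"
    using S \<open>sum p I \<le> 1\<close> by (simp add: S_def)
  finally show ?thesis
    using S by (simp add: S_def)
qed

text \<open>For positive \<open>z\<close> this is monotonicity of both powers. Otherwise the right
  side is nonnegative anyway, which covers the cells whose excess is not positive.\<close>

lemma le_powr_two_thirds:
  fixes z v w :: real
  assumes "z \<le> v" "z \<le> w"
  shows "z \<le> v powr (2/3) * w powr (1/3)"
proof (cases "z \<le> 0")
  case True
  then show ?thesis
    by (rule order.trans) simp
next
  case False
  then have "z = z powr (2/3) * z powr (1/3)"
    by (simp flip: powr_add)
  also have "\<dots> \<le> v powr (2/3) * w powr (1/3)"
    using False assms by (intro mult_mono powr_mono2) auto
  finally show ?thesis .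
qed

text \<open>Used with \<open>a = (1 + \<delta>) * e\<close>, \<open>T\<close> the variation norm and
  \<open>t\<close> the contribution of the atoms. After Young's inequality the coefficients of
  \<open>t + a\<close> and of \<open>T\<^sup>2\<close> are compared separately. Writing
  \<open>c = 4 * r ^ 3\<close> makes both comparisons polynomial.\<close>

lemma final_Young:
  fixes a t c T :: real
  assumes "0 \<le> a" "0 \<le> t" "1 \<le> c"
  shows "(c/4) powr (1/3) * ((a + c * T\<^sup>2 / 4 + t) powr (2/3) * (T\<^sup>2) powr (1/3))
    \<le> c * (2/3 * t + 2/3 * a + (2/3 + (c/4) powr (2/3)) * T\<^sup>2)"
proof -
  define r where "r = (c/4) powr (1/3)"
  have "r ^ 3 = r powr 3"
    using assms by (simp add: r_def powr_realpow)
  also have "\<dots> = c / 4"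
    using assms by (simp add: r_def powr_powr)
  finally have c: "c = 4 * r ^ 3" by simp
  have "r ^ 2 = r powr 2"
    using assms by (simp add: r_def powr_realpow)
  then have r2: "(c/4) powr (2/3) = r\<^sup>2"
    by (simp add: r_def powr_powr)
  have "r \<ge> 0"
    by (simp add: r_def)
  \<comment> \<open>From \<open>1 \<le> c\<close> one gets \<open>r ^ 3 \<ge> 1/4\<close>, which
    exceeds 1/8.\<close>
  have half: "r \<ge> 1/2"
  proof (rule ccontr)
    assume "\<not> ?thesis"
    then have "r ^ 3 \<le> (1/2) ^ 3"
      using \<open>r \<ge> 0\<close> by (intro power_mono) auto
    then show False
      using assms(3) by (simp add: c power3_eq_cube)
  qed
  have "r\<^sup>2 \<ge> (1/2)\<^sup>2"
    using half by (intro power_mono) auto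
  then have r2': "4 * r\<^sup>2 \<ge> 1"
    by (simp add: power2_eq_square)
  have "r * 1 \<le> r * (4 * r\<^sup>2)"
    using r2' \<open>r \<ge> 0\<close> by (intro mult_left_mono)
  then have rc: "r \<le> c"
    by (simp add: c power2_eq_square power3_eq_cube)
  \<comment> \<open>Divided by \<open>r\<close>, this reads
    \<open>2/3 * r ^ 3 + 1/3 \<le> 8/3 * r\<^sup>2 + 4 * r ^ 4\<close>, which follows from
    \<open>r \<ge> 1/2\<close>.\<close>
  have "r * (c / 6 + 1/3) \<le> c * (2/3 + r\<^sup>2)"
  proof -
    have "r ^ 3 * 1 \<le> r ^ 3 * (2 * r)"
      using half \<open>r \<ge> 0\<close> by (intro mult_left_mono) auto
    then have "r ^ 3 \<le> 2 * r ^ 4"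
      by (simp add: eval_nat_numeral mult_ac)
    then have "2/3 * r ^ 3 + 1/3 \<le> 8/3 * r\<^sup>2 + 4 * r ^ 4"
      using r2' zero_le_power[OF \<open>r \<ge> 0\<close>, of 4] by linarith
    then have "r * (2/3 * r ^ 3 + 1/3) \<le> r * (8/3 * r\<^sup>2 + 4 * r ^ 4)"
      using \<open>r \<ge> 0\<close> by (rule mult_left_mono)
    then show ?thesis
      unfolding c by (simp add: algebra_simps eval_nat_numeral)
  qed
  have "r * ((a + c * T\<^sup>2 / 4 + t) powr (2/3) * (T\<^sup>2) powr (1/3))
      \<le> r * (2/3 * (a + c * T\<^sup>2 / 4 + t) + 1/3 * T\<^sup>2)"
    using assms \<open>r \<ge> 0\<close> by (intro mult_left_mono Young_two_thirds) auto
  also have "\<dots> = r * (2/3 * (t + a)) + r * (c / 6 + 1/3) * T\<^sup>2"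
    by (simp add: algebra_simps)
  also have "\<dots> \<le> c * (2/3 * (t + a)) + c * (2/3 + r\<^sup>2) * T\<^sup>2"
    using assms rc \<open>r * (c / 6 + 1/3) \<le> c * (2/3 + r\<^sup>2)\<close>
    by (intro add_mono mult_right_mono) auto
  also have "\<dots> = c * (2/3 * t + 2/3 * a + (2/3 + r\<^sup>2) * T\<^sup>2)"
    by (simp add: algebra_simps)
  finally show ?thesis
    unfolding r2 r_def[symmetric] .
qed

text \<open>The numbers \<open>q * d + r\<close> with \<open>q < k div d\<close> qualify. The bound
  counts the steps among the first \<open>k\<close> that use a given coordinate.\<close>

lemma card_mod_eq_ge:
  fixes d r k :: nat
  assumes "r < d"
  shows "k div d \<le> card {i. i < k \<and> i mod d = r}"
proof -
  have "inj_on (\<lambda>q. q * d + r) {..<k div d}"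
    using assms by (intro inj_onI) auto
  moreover have "(\<lambda>q. q * d + r) ` {..<k div d} \<subseteq> {i. i < k \<and> i mod d = r}"
  proof safe
    fix q assume "q < k div d"
    then have "q * d + d \<le> k div d * d"
      by (metis Suc_leI mult_Suc mult_le_mono1 add.commute)
    then show "q * d + r < k"
      using assms div_times_less_eq_dividend[of k d] by linarith
  qed (use assms in auto)
  ultimately have "card {..<k div d} \<le> card {i. i < k \<and> i mod d = r}"
    by (intro card_inj_on_le) auto
  then show ?thesis by simp
qed

section \<open>The partitions\<close>

lemma minimax_stepE:
  assumes "minimax_step M d X Y j P P'"
  obtains s where
    "\<forall>A\<in>P. \<not> unsplittable M d X Y A \<longrightarrow> minimax_threshold M d X Y A j (s A)"
    "P' = {A \<in> P. unsplittable M d X Y A}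
      \<union> ((\<lambda>A. {x \<in> A. x j < s A}) ` {A \<in> P. \<not> unsplittable M d X Y A}
      \<union> (\<lambda>A. {x \<in> A. x j \<ge> s A}) ` {A \<in> P. \<not> unsplittable M d X Y A})"
proof -
  obtain s where s: "\<forall>A\<in>P. \<not> unsplittable M d X Y A \<longrightarrow> minimax_threshold M d X Y A j (s A)"
    "P' = {A \<in> P. unsplittable M d X Y A} \<union>
             (\<Union>A\<in>{A \<in> P. \<not> unsplittable M d X Y A}.
                {{x \<in> A. x j < s A}, {x \<in> A. x j \<ge> s A}})"
    using assms unfolding minimax_step_def by blast
  show ?thesis
    by (rule that[of s]) (use s in auto)
qed

lemma sum_Un_le:
  fixes f :: "'b \<Rightarrow> real"
  assumes "finite A" "finite B" "\<And>x. f x \<ge> 0"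
  shows "sum f (A \<union> B) \<le> sum f A + sum f B"
  using sum.union_inter[OF assms(1,2), of f] sum_nonneg[of "A \<inter> B" f] assms(3) by simp

text \<open>Unsplit cells are covered by \<open>C \<ge> 1\<close>. Partitions being sets, children
  of different cells may coincide when empty, so sums over images are only bounded above, using that
  \<open>f\<close> is nonnegative.\<close>

lemma sum_minimax_step_le:
  fixes f :: "(nat \<Rightarrow> real) set \<Rightarrow> real"
  assumes step: "minimax_step M d X Y j P P'" and "finite P" and f: "\<And>A. f A \<ge> 0"
    and children: "\<And>A s. A \<in> P \<Longrightarrow> f {x \<in> A. x j < s} + f {x \<in> A. x j \<ge> s} \<le> C * f A"
    and "C \<ge> 1"
  shows "sum f P' \<le> C * sum f P"
proof -
  define U where "U = {A \<in> P. unsplittable M d X Y A}"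
  define S where "S = {A \<in> P. \<not> unsplittable M d X Y A}"
  have PUS: "P = U \<union> S" "U \<inter> S = {}" and fin: "finite U" "finite S"
    using \<open>finite P\<close> by (auto simp: U_def S_def)
  obtain s where P': "P' = U \<union> ((\<lambda>A. {x \<in> A. x j < s A}) ` S \<union> (\<lambda>A. {x \<in> A. x j \<ge> s A}) ` S)"
    unfolding U_def S_def by (rule minimax_stepE[OF step])
  have "sum f P' \<le> sum f U
      + (sum f ((\<lambda>A. {x \<in> A. x j < s A}) ` S) + sum f ((\<lambda>A. {x \<in> A. x j \<ge> s A}) ` S))"
    unfolding P' using fin f by (intro order.trans[OF sum_Un_le] add_left_mono sum_Un_le) auto
  also have "\<dots> \<le> sum f U + ((\<Sum>A\<in>S. f {x \<in> A. x j < s A}) + (\<Sum>A\<in>S. f {x \<in> A. x j \<ge> s A}))"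
    using fin f sum_image_le[of S f "\<lambda>A. {x \<in> A. x j < s A}"]
      sum_image_le[of S f "\<lambda>A. {x \<in> A. x j \<ge> s A}"]
    by (intro add_left_mono add_mono) (auto simp: o_def)
  also have "\<dots> \<le> (\<Sum>A\<in>U. C * f A) + (\<Sum>A\<in>S. C * f A)"
    unfolding sum.distrib[symmetric] using children mult_right_mono[OF \<open>C \<ge> 1\<close> f]
    by (intro add_mono sum_mono) (auto simp: S_def)
  also have "\<dots> = C * sum f P"
    unfolding PUS(1) using fin PUS(2) by (simp add: sum.union_disjoint sum_distrib_left distrib_left)
  finally show ?thesis .
qed

context regression_setting
begin

text \<open>Unlike \<open>partition_on\<close>, this admits the empty set as a cell: a threshold at
  the lower end of a side leaves an empty half.\<close>

definition cell_partition :: "(nat \<Rightarrow> real) set set \<Rightarrow> bool" where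
  "cell_partition P \<longleftrightarrow> finite P \<and> P \<subseteq> sets (borel_Rd d) \<and> disjoint P \<and> \<Union>P = Rd d"

text \<open>\<open>G\<close> is prescribed cell by cell, the way \<open>associated_process\<close>
  determines \<open>Mk\<close>, and integrability is asked of the functions \<open>f A\<close>
  only.\<close>

lemma integral_cell_partition:
  assumes P: "cell_partition P" and int: "\<And>A. A \<in> P \<Longrightarrow> integrable M (f A)"
    and F: "\<And>A \<omega>. A \<in> P \<Longrightarrow> \<omega> \<in> cell A \<Longrightarrow> G \<omega> = f A \<omega>"
  shows "(\<integral>\<omega>. G \<omega> \<partial>M) = (\<Sum>A\<in>P. (LINT \<omega>:cell A|M. (f A \<omega> :: real)))"
proof -
  have fin: "finite P" and meas: "\<And>A. A \<in> P \<Longrightarrow> A \<in> sets (borel_Rd d)"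
    using P by (auto simp: cell_partition_def)
  have "G \<omega> = (\<Sum>A\<in>P. indicator (cell A) \<omega> * f A \<omega>)" if \<omega>: "\<omega> \<in> space M" for \<omega>
  proof -
    have "X \<omega> \<in> \<Union>P"
      using measurable_space[OF X_measurable \<omega>] P by (simp add: cell_partition_def space_PiM)
    then obtain A where A: "A \<in> P" "X \<omega> \<in> A" by blast
    have "(\<Sum>B\<in>P. indicator (cell B) \<omega> * f B \<omega>) = (\<Sum>B\<in>P. if B = A then f A \<omega> else 0)"
    proof (rule sum.cong)
      fix B assume "B \<in> P"
      then have "B = A \<longleftrightarrow> \<omega> \<in> cell B"
        using A \<omega> P unfolding cell_event_def cell_partition_def disjoint_def by blast
      then show "indicator (cell B) \<omega> * f B \<omega> = (if B = A then f A \<omega> else 0)"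
        by auto
    qed simp
    also have "\<dots> = G \<omega>"
      using A fin \<omega> F[of A \<omega>] by (simp add: cell_event_def)
    finally show ?thesis by simp
  qed
  then have "(\<integral>\<omega>. G \<omega> \<partial>M) = (\<integral>\<omega>. (\<Sum>A\<in>P. indicator (cell A) \<omega> * f A \<omega>) \<partial>M)"
    by (intro Bochner_Integration.integral_cong) auto
  also have "\<dots> = (\<Sum>A\<in>P. (\<integral>\<omega>. indicator (cell A) \<omega> * f A \<omega> \<partial>M))"
    using int meas set_integrable_of_integrable[OF cell_measurable[OF meas] int]
    by (intro Bochner_Integration.integral_sum) (simp add: set_integrable_def)
  finally show ?thesis
    by (simp add: set_lebesgue_integral_def)
qed

lemma sum_prob_cells:
  assumes "cell_partition P"
  shows "(\<Sum>A\<in>P. prob (cell A)) = 1"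
proof -
  have "(\<integral>\<omega>. 1 \<partial>M) = (\<Sum>A\<in>P. (LINT \<omega>:cell A|M. (1::real)))"
    by (rule integral_cell_partition[OF assms]) auto
  also have "\<dots> = (\<Sum>A\<in>P. prob (cell A))"
    using assms by (intro sum.cong) (auto simp: set_lebesgue_integral_def cell_partition_def subset_iff)
  finally show ?thesis
    by (simp add: prob_space)
qed

lemma Rd_measurable: "Rd d \<in> sets (borel_Rd d)"
  using sets.top[of "borel_Rd d"] by (simp add: space_PiM)

lemma cell_partition_step:
  assumes step: "minimax_step M d X Y j P P'" and P: "cell_partition P" and j: "j \<in> {1..d}"
  shows "cell_partition P'"
proof -
  obtain s where P': "P' = {A \<in> P. unsplittable M d X Y A}
      \<union> ((\<lambda>A. {x \<in> A. x j < s A}) ` {A \<in> P. \<not> unsplittable M d X Y A}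
      \<union> (\<lambda>A. {x \<in> A. x j \<ge> s A}) ` {A \<in> P. \<not> unsplittable M d X Y A})"
    by (rule minimax_stepE[OF step])
  have parent: "\<exists>A\<in>P. B \<subseteq> A \<and> (unsplittable M d X Y A \<and> B = A \<or> \<not> unsplittable M d X Y A \<and>
      (B = {x \<in> A. x j < s A} \<or> B = {x \<in> A. x j \<ge> s A}))" if "B \<in> P'" for B
    using that unfolding P' by blast
  have "disjoint P'"
  proof (rule disjointI)
    fix B B' assume "B \<in> P'" "B' \<in> P'" "B \<noteq> B'"
    obtain A where A: "A \<in> P" "B \<subseteq> A" "unsplittable M d X Y A \<and> B = A \<or> \<not> unsplittable M d X Y A \<and>
      (B = {x \<in> A. x j < s A} \<or> B = {x \<in> A. x j \<ge> s A})"
      using parent[OF \<open>B \<in> P'\<close>] by blast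
    obtain A' where A': "A' \<in> P" "B' \<subseteq> A'" "unsplittable M d X Y A' \<and> B' = A' \<or> \<not> unsplittable M d X Y A' \<and>
      (B' = {x \<in> A'. x j < s A'} \<or> B' = {x \<in> A'. x j \<ge> s A'})"
      using parent[OF \<open>B' \<in> P'\<close>] by blast
    show "B \<inter> B' = {}"
    proof (cases "A = A'")
      case True
      then show ?thesis
        using A(3) A'(3) \<open>B \<noteq> B'\<close> by auto
    next
      case False
      then have "A \<inter> A' = {}"
        using P A(1) A'(1) by (auto simp: cell_partition_def disjoint_def)
      then show ?thesis
        using A(2) A'(2) by blast
    qed
  qed
  moreover have "\<Union>P' = \<Union>P"
    unfolding P' by (auto simp: not_less[symmetric]; fastforce)
  moreover have "P' \<subseteq> sets (borel_Rd d)" "finite P'"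
    using P halfspace_measurable[OF j] unfolding P' cell_partition_def by auto
  ultimately show ?thesis
    using P by (simp add: cell_partition_def)
qed

lemma cyclic_coordinate: "1 + k mod d \<in> {1..d}"
  using mod_less_divisor[of d k] d_pos by (auto simp: Suc_le_eq)

section \<open>Risk and variation of the cells at depth \<open>k\<close>\<close>

context
  fixes \<pi> :: "nat \<Rightarrow> (nat \<Rightarrow> real) set set"
  assumes cyclic: "cyclic_minimax_split M d X Y \<pi>"
begin

lemma \<pi>_0: "\<pi> 0 = {Rd d}" and \<pi>_step: "minimax_step M d X Y (1 + k mod d) (\<pi> k) (\<pi> (Suc k))"
  using cyclic by (auto simp: cyclic_minimax_split_def)

lemma cell_partition_\<pi>: "cell_partition (\<pi> k)"
proof (induction k)
  case 0
  then show ?case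
    using Rd_measurable by (simp add: \<pi>_0 cell_partition_def)
next
  case (Suc k)
  then show ?case
    using cell_partition_step[OF \<pi>_step _ cyclic_coordinate] by blast
qed

lemma finite_\<pi>: "finite (\<pi> k)" and \<pi>_measurable: "A \<in> \<pi> k \<Longrightarrow> A \<in> sets (borel_Rd d)"
  using cell_partition_\<pi>[of k] by (auto simp: cell_partition_def)

text \<open>A split sends a bound \<open>v\<close> to \<open>v / 2 + w\<close> with
  \<open>w = (hi - lo)\<^sup>2 / N\<close>, a map with fixed point \<open>2 * w\<close>;
  unsplittable cells have risk at most \<open>w\<close>.\<close>

lemma \<pi>_risk:
  "A \<in> \<pi> k \<Longrightarrow> risk M Y (cell A) \<le> risk M Y (cell (Rd d)) / 2 ^ k + 2 * ((hi - lo)\<^sup>2 / N)"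
proof (induction k arbitrary: A)
  case 0
  then show ?case
    using N_pos by (simp add: \<pi>_0)
next
  case (Suc k)
  define V where "V = risk M Y (cell (Rd d))"
  define w where "w = (hi - lo)\<^sup>2 / N"
  have nonneg: "V / 2 ^ Suc k \<ge> 0" "w \<ge> 0"
    using N_pos risk_nonneg by (auto simp: V_def w_def)
  obtain s where s: "\<forall>A\<in>\<pi> k. \<not> unsplittable M d X Y A \<longrightarrow>
      minimax_threshold M d X Y A (1 + k mod d) (s A)"
    and \<pi>: "\<pi> (Suc k) = {A \<in> \<pi> k. unsplittable M d X Y A}
      \<union> ((\<lambda>A. {x \<in> A. x (1 + k mod d) < s A}) ` {A \<in> \<pi> k. \<not> unsplittable M d X Y A}
      \<union> (\<lambda>A. {x \<in> A. x (1 + k mod d) \<ge> s A}) ` {A \<in> \<pi> k. \<not> unsplittable M d X Y A})"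
    by (rule minimax_stepE[OF \<pi>_step[of k]])
  from Suc.prems consider "A \<in> \<pi> k" "unsplittable M d X Y A"
    | B where "B \<in> \<pi> k" "\<not> unsplittable M d X Y B"
      "A = {x \<in> B. x (1 + k mod d) < s B} \<or> A = {x \<in> B. x (1 + k mod d) \<ge> s B}"
    unfolding \<pi> by blast
  then have "risk M Y (cell A) \<le> V / 2 ^ Suc k + 2 * w"
  proof cases
    case 1
    then have "risk M Y (cell A) \<le> w"
      using unsplittable_risk \<pi>_measurable by (simp add: w_def)
    then show ?thesis
      using nonneg by linarith
  next
    case 2
    then have "risk M Y (cell A) \<le> risk M Y (cell B) / 2 + w"
      using minimax_split_risk[OF cyclic_coordinate \<pi>_measurable[OF 2(1)] 2(2)] s 2
      by (auto simp: w_def)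
    also have "risk M Y (cell B) \<le> V / 2 ^ k + 2 * w"
      using Suc.IH[OF 2(1)] by (simp add: V_def w_def)
    finally show ?thesis
      by (simp add: add_divide_distrib mult.commute)
  qed
  then show ?case
    by (simp add: V_def w_def)
qed

text \<open>As \<open>v\<close> is monotone, a split in coordinate \<open>j\<close> gives images
  lying side by side, whose diameters add up to at most that of the parent; any other split at most
  doubles the sum. Coordinate \<open>j\<close> is used in at least \<open>k div d\<close> of the
  first \<open>k\<close> steps.\<close>

lemma \<pi>_diameter:
  fixes v :: "real \<Rightarrow> real"
  assumes j: "j \<in> {1..d}" and v: "mono v" and bdd: "\<And>S. bounded (v ` S)"
  shows "2 ^ (k div d) * (\<Sum>A\<in>\<pi> k. diameter ((\<lambda>x. v (x j)) ` A))
    \<le> 2 ^ k * diameter ((\<lambda>x. v (x j)) ` Rd d)"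
proof -
  define f where "f A = diameter ((\<lambda>x. v (x j)) ` A)" for A :: "(nat \<Rightarrow> real) set"
  \<comment> \<open>Step \<open>i\<close> splits coordinate \<open>1 + i mod d\<close>, hence the
    residue \<open>j - 1\<close>.\<close>
  define n where "n k = card {i. i < k \<and> i mod d = j - 1}" for k
  have bdd': "bounded ((\<lambda>x. v (x j)) ` A)" for A :: "(nat \<Rightarrow> real) set"
    using bdd[of "(\<lambda>x. x j) ` A"] by (simp add: image_image)
  have f_nonneg: "f A \<ge> 0" for A
    using diameter_ge_0[OF bdd'] by (simp add: f_def)
  have f_mono: "f A \<le> f B" if "A \<subseteq> B" for A B
    using that unfolding f_def by (intro diameter_subset bdd') auto
  have split: "f {x \<in> A. x j < s} + f {x \<in> A. x j \<ge> s} \<le> f A" for A s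
  proof -
    have "(\<lambda>x. v (x j)) ` {x \<in> A. x j < s} \<union> (\<lambda>x. v (x j)) ` {x \<in> A. x j \<ge> s} = (\<lambda>x. v (x j)) ` A"
      by force
    moreover have "v (x j) \<le> v (y j)" if "x j < s" "y j \<ge> s" for x y
      using that by (intro monoD[OF v]) auto
    ultimately show ?thesis
      using diameter_split_le[of "(\<lambda>x. v (x j)) ` {x \<in> A. x j < s}" "(\<lambda>x. v (x j)) ` {x \<in> A. x j \<ge> s}"]
        bdd'[of A]
      unfolding f_def by fastforce
  qed
  have "2 ^ n k * sum f (\<pi> k) \<le> 2 ^ k * f (Rd d)"
  proof (induction k)
    case 0
    then show ?case by (simp add: \<pi>_0 n_def)
  next
    case (Suc k)
    show ?case
    proof (cases "k mod d = j - 1")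
      case True
      then have "{i. i < Suc k \<and> i mod d = j - 1} = insert k {i. i < k \<and> i mod d = j - 1}"
        by (auto simp: less_Suc_eq)
      then have n: "n (Suc k) = Suc (n k)"
        by (simp add: n_def)
      have "1 + k mod d = j"
        using True j by auto
      then have "sum f (\<pi> (Suc k)) \<le> 1 * sum f (\<pi> k)"
        using split f_nonneg finite_\<pi> \<pi>_step[of k] by (intro sum_minimax_step_le) auto
      then have "2 ^ n (Suc k) * sum f (\<pi> (Suc k)) \<le> 2 * (2 ^ n k * sum f (\<pi> k))"
        by (simp add: n)
      with Suc show ?thesis by simp
    next
      case False
      then have "{i. i < Suc k \<and> i mod d = j - 1} = {i. i < k \<and> i mod d = j - 1}"
        by (auto simp: less_Suc_eq)
      then have n: "n (Suc k) = n k"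
        by (simp add: n_def)
      have "f {x \<in> A. x i < s} + f {x \<in> A. x i \<ge> s} \<le> 2 * f A" for A i s
        using f_mono[of "{x \<in> A. x i < s}" A] f_mono[of "{x \<in> A. x i \<ge> s}" A] by auto
      then have "sum f (\<pi> (Suc k)) \<le> 2 * sum f (\<pi> k)"
        using f_nonneg finite_\<pi> \<pi>_step[of k] by (intro sum_minimax_step_le) auto
      then have "2 ^ n k * sum f (\<pi> (Suc k)) \<le> 2 ^ n k * (2 * sum f (\<pi> k))"
        by (rule mult_left_mono) simp
      with Suc have "2 ^ n k * sum f (\<pi> (Suc k)) \<le> 2 * (2 ^ k * f (Rd d))"
        by linarith
      then show ?thesis by (simp add: n)
    qed
  qed
  moreover have "(2::real) ^ (k div d) \<le> 2 ^ n k"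
    using card_mod_eq_ge[of "j - 1" d k] j by (intro power_increasing) (auto simp: n_def)
  then have "2 ^ (k div d) * sum f (\<pi> k) \<le> 2 ^ n k * sum f (\<pi> k)"
    using f_nonneg by (intro mult_right_mono sum_nonneg) auto
  ultimately show ?thesis
    unfolding f_def by linarith
qed

end

end

section \<open>Comparison with additive functions\<close>

lemma square_sum_le:
  fixes u w \<delta> :: real
  assumes "\<delta> > 0"
  shows "(u + w)\<^sup>2 \<le> (1 + \<delta>) * u\<^sup>2 + (1 + 1 / \<delta>) * w\<^sup>2"
proof -
  have "0 \<le> (\<delta> * u - w)\<^sup>2 / \<delta>"
    using assms by simp
  then show ?thesis
    using assms by (simp add: power2_eq_square field_simps)
qed

context regression_setting
begin

context
  fixes h :: "nat \<Rightarrow> real \<Rightarrow> real"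
begin

definition additive :: "(nat \<Rightarrow> real) \<Rightarrow> real" where
  "additive x = (\<Sum>i\<in>{1..d}. h i (x i))"

text \<open>The variation functions are used instead of the components themselves because they are
  monotone, so that the diameters of the two halves of a split cell add up.\<close>

definition spread :: "(nat \<Rightarrow> real) set \<Rightarrow> real" where
  "spread A = (\<Sum>i\<in>{1..d}. diameter ((\<lambda>x. variation_upto (h i) (x i)) ` A))"

text \<open>The norm of the single representation \<open>h\<close>; the infimum over all
  representations is taken only in the final theorem.\<close>

definition variation_norm :: real where
  "variation_norm = (\<Sum>i\<in>{1..d}. real_of_ereal (total_variation (h i)))"

context
  assumes BV: "\<And>i. i \<in> {1..d} \<Longrightarrow> total_variation (h i) < \<infinity>"
begin

lemma bounded_variation_image:
  "i \<in> {1..d} \<Longrightarrow> bounded ((\<lambda>x. variation_upto (h i) (x i)) ` A)"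
  using bounded_variation_upto[OF BV, of i "(\<lambda>x. x i) ` A"] by (simp add: image_image)

lemma spread_nonneg: "spread A \<ge> 0"
  unfolding spread_def by (intro sum_nonneg diameter_ge_0 bounded_variation_image)

lemma spread_le_variation_norm: "spread A \<le> variation_norm"
  unfolding spread_def variation_norm_def
proof (rule sum_mono)
  fix i assume "i \<in> {1..d}"
  then show "diameter ((\<lambda>x. variation_upto (h i) (x i)) ` A) \<le> real_of_ereal (total_variation (h i))"
    using diameter_variation_upto_le[OF BV, of i "(\<lambda>x. x i) ` A"] by (simp add: image_image)
qed

lemma additive_diff_le_spread:
  assumes "x \<in> A" "y \<in> A"
  shows "\<bar>additive x - additive y\<bar> \<le> spread A"
proof -
  have "\<bar>h i (x i) - h i (y i)\<bar> \<le> diameter ((\<lambda>x. variation_upto (h i) (x i)) ` A)"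
    if i: "i \<in> {1..d}" for i
  proof -
    have "\<bar>h i (x i) - h i (y i)\<bar> \<le> dist (variation_upto (h i) (x i)) (variation_upto (h i) (y i))"
      unfolding dist_real_def by (rule abs_diff_le_variation_upto[OF BV[OF i]])
    also have "\<dots> \<le> diameter ((\<lambda>x. variation_upto (h i) (x i)) ` A)"
      using assms by (intro diameter_bounded_bound bounded_variation_image i) auto
    finally show ?thesis .
  qed
  then show ?thesis
    unfolding additive_def spread_def sum_subtractf[symmetric]
    by (intro order.trans[OF sum_abs] sum_mono)
qed

lemma additive_X_measurable [measurable]: "(\<lambda>\<omega>. additive (X \<omega>)) \<in> borel_measurable M"
  unfolding additive_def
proof (rule borel_measurable_sum)
  fix i assume i: "i \<in> {1..d}"
  show "(\<lambda>\<omega>. h i (X \<omega> i)) \<in> borel_measurable M"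
    using measurable_compose[OF measurable_compose[OF X_measurable measurable_component_singleton[OF i]]
        BV_borel_measurable[OF BV[OF i]]] .
qed

lemma integrable_residual_sq: "integrable M (\<lambda>\<omega>. (Y \<omega> - additive (X \<omega>))\<^sup>2)"
proof (rule Bochner_Integration.integrable_bound)
  \<comment> \<open>\<open>additive\<close> is bounded: it stays within \<open>spread UNIV\<close>
    of its value at the zero function. That function need not lie in \<open>Rd d\<close>, hence
    \<open>UNIV\<close>.\<close>
  define c where "c = additive (\<lambda>_. 0)"
  show "integrable M (\<lambda>\<omega>. 2 * (Y \<omega> - c)\<^sup>2 + 2 * (spread UNIV)\<^sup>2)"
    using integrable_dev by simp
  show "AE \<omega> in M. norm ((Y \<omega> - additive (X \<omega>))\<^sup>2) \<le> norm (2 * (Y \<omega> - c)\<^sup>2 + 2 * (spread UNIV)\<^sup>2)"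
  proof (intro AE_I2)
    fix \<omega>
    have "(Y \<omega> - additive (X \<omega>))\<^sup>2 = ((Y \<omega> - c) + (c - additive (X \<omega>)))\<^sup>2"
      by simp
    also have "\<dots> \<le> 2 * (Y \<omega> - c)\<^sup>2 + 2 * (c - additive (X \<omega>))\<^sup>2"
      using square_sum_le[of 1 "Y \<omega> - c" "c - additive (X \<omega>)"] by simp
    also have "(c - additive (X \<omega>))\<^sup>2 \<le> (spread UNIV)\<^sup>2"
      using additive_diff_le_spread[of "\<lambda>_. 0" UNIV "X \<omega>"] spread_nonneg[of UNIV]
      by (simp add: c_def abs_le_square_iff[symmetric])
    finally show "norm ((Y \<omega> - additive (X \<omega>))\<^sup>2) \<le> norm (2 * (Y \<omega> - c)\<^sup>2 + 2 * (spread UNIV)\<^sup>2)"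
      by simp
  qed
qed measurable

text \<open>The centre is chosen within half the spread of all values of \<open>additive\<close> on
  the cell; \<open>square_sum_le\<close> then separates the residual from the oscillation.\<close>

lemma risk_cell_le:
  assumes A: "A \<in> sets (borel_Rd d)" and "\<delta> > 0"
  shows "risk M Y (cell A) \<le> (1 + \<delta>) * (LINT \<omega>:cell A|M. (Y \<omega> - additive (X \<omega>))\<^sup>2)
    + (1 + 1 / \<delta>) * ((spread A)\<^sup>2 / 4 * prob (cell A))"
proof -
  obtain c where c: "\<And>x. x \<in> A \<Longrightarrow> \<bar>additive x - c\<bar> \<le> spread A / 2"
    using ex_midpoint[of A additive "spread A"] additive_diff_le_spread by blast
  note E = cell_measurable[OF A]
  note int = set_integrable_of_integrable[OF E]
  have i1: "set_integrable M (cell A) (\<lambda>\<omega>. (1 + \<delta>) * (Y \<omega> - additive (X \<omega>))\<^sup>2)"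
    using integrable_residual_sq by (intro int) auto
  have i2: "set_integrable M (cell A) (\<lambda>\<omega>. (1 + 1 / \<delta>) * ((spread A)\<^sup>2 / 4))"
    by (intro int) auto
  have "risk M Y (cell A) \<le> (LINT \<omega>:cell A|M. (Y \<omega> - c)\<^sup>2)"
    by (rule risk_le_dev[OF E])
  also have "\<dots> \<le> (LINT \<omega>:cell A|M. (1 + \<delta>) * (Y \<omega> - additive (X \<omega>))\<^sup>2
      + (1 + 1 / \<delta>) * ((spread A)\<^sup>2 / 4))"
  proof (rule set_integral_mono[OF int[OF integrable_dev] set_integral_add(1)[OF i1 i2]])
    fix \<omega> assume "\<omega> \<in> cell A"
    then have "\<bar>additive (X \<omega>) - c\<bar> \<le> \<bar>spread A / 2\<bar>"
      using c[of "X \<omega>"] by (simp add: cell_event_def)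
    then have "(additive (X \<omega>) - c)\<^sup>2 \<le> (spread A)\<^sup>2 / 4"
      by (simp add: abs_le_square_iff power_divide del: abs_divide)
    then have "(1 + 1 / \<delta>) * (additive (X \<omega>) - c)\<^sup>2 \<le> (1 + 1 / \<delta>) * ((spread A)\<^sup>2 / 4)"
      using \<open>\<delta> > 0\<close> by (intro mult_left_mono) auto
    then show "(Y \<omega> - c)\<^sup>2 \<le> (1 + \<delta>) * (Y \<omega> - additive (X \<omega>))\<^sup>2 + (1 + 1 / \<delta>) * ((spread A)\<^sup>2 / 4)"
      using square_sum_le[OF \<open>\<delta> > 0\<close>, of "Y \<omega> - additive (X \<omega>)" "additive (X \<omega>) - c"]
      unfolding diff_add_cancel diff_add_eq add_diff_eq by linarith
  qed
  also have "\<dots> = (LINT \<omega>:cell A|M. (1 + \<delta>) * (Y \<omega> - additive (X \<omega>))\<^sup>2)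
      + (LINT \<omega>:cell A|M. (1 + 1 / \<delta>) * ((spread A)\<^sup>2 / 4))"
    by (rule set_integral_add(2)[OF i1 i2])
  also have "(LINT \<omega>:cell A|M. (1 + 1 / \<delta>) * ((spread A)\<^sup>2 / 4))
      = (1 + 1 / \<delta>) * ((spread A)\<^sup>2 / 4 * prob (cell A))"
    using E unfolding set_lebesgue_integral_def by simp
  finally show ?thesis by simp
qed

text \<open>The bound for one fixed representation. The two estimates of a cell's risk, from the
  algorithm and from \<open>additive\<close>, are interpolated cell by cell before
  summation.\<close>

lemma cyclic_minimax_bound:
  fixes k :: nat
  assumes cyclic: "cyclic_minimax_split M d X Y \<pi>"
    and proc: "associated_process M X Y \<pi> Mk" and "\<delta> > 0"
  defines "K \<equiv> k div d"
    and "e \<equiv> (\<integral>\<omega>. (Y \<omega> - additive (X \<omega>))\<^sup>2 \<partial>M)"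
    and "c \<equiv> 1 + 1 / \<delta>" and "t \<equiv> 2 ^ (k + 1) * ((hi - lo)\<^sup>2 / N)" and "T \<equiv> variation_norm"
  shows "(\<integral>\<omega>. (Y \<omega> - Mk k \<omega>)\<^sup>2 \<partial>M)
    \<le> (1 + \<delta>) * e + 2 powr (- 2 * real K / 3)
        * (c * (2/3 * t + 2/3 * ((1 + \<delta>) * e) + (2/3 + (c / 4) powr (2/3)) * T\<^sup>2))"
proof -
  note P = cell_partition_\<pi>[OF cyclic, of k]
  note fin = finite_\<pi>[OF cyclic, of k] and meas = \<pi>_measurable[OF cyclic, of _ k]
  define V where "V = risk M Y (cell (Rd d))"
  define v where "v = V / 2 ^ k + 2 * ((hi - lo)\<^sup>2 / N)"
  define r where "r A = (LINT \<omega>:cell A|M. (Y \<omega> - additive (X \<omega>))\<^sup>2)" for A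
  define p where "p A = prob (cell A)" for A
  have c: "c \<ge> 1" and e: "e \<ge> 0" and t: "t \<ge> 0" and V: "V \<ge> 0" and T: "T \<ge> 0"
    using \<open>\<delta> > 0\<close> N_pos risk_nonneg spread_nonneg[of "{}"] spread_le_variation_norm[of "{}"]
    by (auto simp: c_def e_def t_def V_def T_def)
  have v: "v \<ge> 0"
    using V N_pos by (simp add: v_def)
  have "(\<integral>\<omega>. (Y \<omega> - Mk k \<omega>)\<^sup>2 \<partial>M)
      = (\<Sum>A\<in>\<pi> k. (LINT \<omega>:cell A|M. (Y \<omega> - cond_mean M Y (cell A))\<^sup>2))"
    using proc by (intro integral_cell_partition P integrable_dev) (auto simp: associated_process_def)
  also have "\<dots> = (\<Sum>A\<in>\<pi> k. risk M Y (cell A))"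
    using meas by (intro sum.cong) (auto simp: risk_eq_dev)
  also have "\<dots> \<le> (\<Sum>A\<in>\<pi> k. (1 + \<delta>) * r A
      + v powr (2/3) * (c / 4) powr (1/3) * (spread A powr (2/3) * p A powr (1/3)))"
  proof (rule sum_mono)
    fix A assume A: "A \<in> \<pi> k"
    have "r A \<ge> 0"
      unfolding r_def set_lebesgue_integral_def by (intro Bochner_Integration.integral_nonneg) auto
    then have "risk M Y (cell A) - (1 + \<delta>) * r A \<le> v"
      using \<pi>_risk[OF cyclic A] \<open>\<delta> > 0\<close> unfolding v_def V_def
      by (smt (verit) mult_nonneg_nonneg)
    moreover have "risk M Y (cell A) - (1 + \<delta>) * r A \<le> c * ((spread A)\<^sup>2 / 4 * p A)"
      using risk_cell_le[OF meas[OF A] \<open>\<delta> > 0\<close>] unfolding r_def p_def c_def by linarith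
    ultimately have "risk M Y (cell A) - (1 + \<delta>) * r A
        \<le> v powr (2/3) * (c * ((spread A)\<^sup>2 / 4 * p A)) powr (1/3)"
      by (rule le_powr_two_thirds)
    also have "c * ((spread A)\<^sup>2 / 4 * p A) = (c / 4) * ((spread A)\<^sup>2 * p A)"
      by simp
    also have "\<dots> powr (1/3) = (c / 4) powr (1/3) * (((spread A)\<^sup>2) powr (1/3) * p A powr (1/3))"
      using c unfolding p_def by (subst powr_mult powr_mult; simp)+
    also have "((spread A)\<^sup>2) powr (1/3) = spread A powr (2/3)"
      using spread_nonneg[of A] by (simp add: powr_powr flip: powr_numeral)
    finally show "risk M Y (cell A) \<le> (1 + \<delta>) * r A
      + v powr (2/3) * (c / 4) powr (1/3) * (spread A powr (2/3) * p A powr (1/3))"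
      by (simp add: mult.assoc)
  qed
  also have "\<dots> = (1 + \<delta>) * e
      + v powr (2/3) * (c / 4) powr (1/3) * (\<Sum>A\<in>\<pi> k. spread A powr (2/3) * p A powr (1/3))"
  proof -
    have "e = sum r (\<pi> k)"
      unfolding r_def e_def by (rule integral_cell_partition[OF P integrable_residual_sq]) auto
    then show ?thesis
      by (simp add: sum.distrib sum_distrib_left)
  qed
  finally have risk_sum: "(\<integral>\<omega>. (Y \<omega> - Mk k \<omega>)\<^sup>2 \<partial>M) \<le> (1 + \<delta>) * e
      + v powr (2/3) * (c / 4) powr (1/3) * (\<Sum>A\<in>\<pi> k. spread A powr (2/3) * p A powr (1/3))" .
  have Hoelder: "(\<Sum>A\<in>\<pi> k. spread A powr (2/3) * p A powr (1/3)) \<le> sum spread (\<pi> k) powr (2/3)"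
    using sum_prob_cells[OF P] spread_nonneg by (intro Hoelder_two_thirds fin) (auto simp: p_def)
  have "v powr (2/3) * (c / 4) powr (1/3) * (\<Sum>A\<in>\<pi> k. spread A powr (2/3) * p A powr (1/3))
      \<le> v powr (2/3) * (c / 4) powr (1/3) * sum spread (\<pi> k) powr (2/3)"
    using Hoelder by (rule mult_left_mono) simp
  also have "v powr (2/3) * (c / 4) powr (1/3) * sum spread (\<pi> k) powr (2/3)
      \<le> 2 powr (- 2 * real K / 3) * ((c / 4) powr (1/3) * (((1 + \<delta>) * e + c * T\<^sup>2 / 4 + t) powr (2/3)
          * (T\<^sup>2) powr (1/3)))"
  proof -
    have "2 ^ K * sum spread (\<pi> k)
        = (\<Sum>i\<in>{1..d}. 2 ^ K * (\<Sum>A\<in>\<pi> k. diameter ((\<lambda>x. variation_upto (h i) (x i)) ` A)))"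
      unfolding spread_def by (subst sum.swap) (simp add: sum_distrib_left)
    also have "\<dots> \<le> (\<Sum>i\<in>{1..d}. 2 ^ k * diameter ((\<lambda>x. variation_upto (h i) (x i)) ` Rd d))"
      unfolding K_def
      by (intro sum_mono \<pi>_diameter[OF cyclic] mono_variation_upto bounded_variation_upto BV)
    also have "\<dots> = 2 ^ k * spread (Rd d)"
      by (simp add: spread_def sum_distrib_left)
    also have "\<dots> \<le> 2 ^ k * T"
      using spread_le_variation_norm by (simp add: T_def)
    finally have spread: "sum spread (\<pi> k) \<le> 2 ^ k * T / 2 ^ K"
      by (simp add: field_simps)
    have "cell (Rd d) = space M"
      using measurable_space[OF X_measurable] by (auto simp: cell_event_def space_PiM)
    \<comment> \<open>The comparison with \<open>additive\<close> is applied once more, to the whole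
      space, so that the initial risk is also expressed by \<open>e\<close> and
      \<open>T\<close>.\<close>
    then have "V \<le> (1 + \<delta>) * e + c * ((spread (Rd d))\<^sup>2 / 4)"
      using risk_cell_le[OF Rd_measurable \<open>\<delta> > 0\<close>] integrable_residual_sq
      by (simp add: V_def e_def c_def prob_space set_integral_space)
    also have "c * ((spread (Rd d))\<^sup>2 / 4) \<le> c * (T\<^sup>2 / 4)"
      using c spread_nonneg spread_le_variation_norm
      by (intro mult_left_mono divide_right_mono power_mono) (auto simp: T_def)
    finally have V_le: "V \<le> (1 + \<delta>) * e + c * T\<^sup>2 / 4" by simp
    \<comment> \<open>Since \<open>2 ^ k * v = V + t\<close>, the possible doubling of the spread at
      each step is offset by the halving of the risk, and the gain \<open>1 / 2 ^ K\<close>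
      remains.\<close>
    have "v * sum spread (\<pi> k) \<le> v * (2 ^ k * T / 2 ^ K)"
      using v spread by (rule mult_left_mono[rotated])
    also have "\<dots> = (V + t) * T / 2 ^ K"
      by (simp add: v_def t_def field_simps)
    also have "\<dots> \<le> ((1 + \<delta>) * e + c * T\<^sup>2 / 4 + t) * T / 2 ^ K"
      using V_le T by (intro divide_right_mono mult_right_mono) auto
    finally have "(v * sum spread (\<pi> k)) powr (2/3)
        \<le> (((1 + \<delta>) * e + c * T\<^sup>2 / 4 + t) * T / 2 ^ K) powr (2/3)"
      using v spread_nonneg by (intro powr_mono2) (auto intro!: mult_nonneg_nonneg sum_nonneg)
    also have "\<dots> = ((1 + \<delta>) * e + c * T\<^sup>2 / 4 + t) powr (2/3) * T powr (2/3) / (2 ^ K) powr (2/3)"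
      using e c t T \<open>\<delta> > 0\<close> by (simp add: powr_mult powr_divide)
    also have "T powr (2/3) = (T\<^sup>2) powr (1/3)"
      using T by (simp add: powr_powr flip: powr_numeral)
    also have "(2 ^ K) powr (2/3) = (2 powr (2 * real K / 3) :: real)"
      by (simp add: powr_powr mult.commute flip: powr_realpow)
    finally have "(v * sum spread (\<pi> k)) powr (2/3) \<le> 2 powr (- 2 * real K / 3)
        * (((1 + \<delta>) * e + c * T\<^sup>2 / 4 + t) powr (2/3) * (T\<^sup>2) powr (1/3))"
      by (simp add: powr_minus_divide)
    then have "(c / 4) powr (1/3) * (v * sum spread (\<pi> k)) powr (2/3)
        \<le> (c / 4) powr (1/3) * (2 powr (- 2 * real K / 3)
        * (((1 + \<delta>) * e + c * T\<^sup>2 / 4 + t) powr (2/3) * (T\<^sup>2) powr (1/3)))"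
      by (rule mult_left_mono) simp
    then show ?thesis
      using v spread_nonneg by (simp add: powr_mult sum_nonneg mult_ac)
  qed
  also have "\<dots> \<le> 2 powr (- 2 * real K / 3)
      * (c * (2/3 * t + 2/3 * ((1 + \<delta>) * e) + (2/3 + (c / 4) powr (2/3)) * T\<^sup>2))"
    using e t c \<open>\<delta> > 0\<close> by (intro mult_left_mono final_Young) auto
  finally show ?thesis
    using risk_sum by linarith
qed

end

end

end

section \<open>Supports\<close>

context prob_space
begin

text \<open>The complement of the support is a union of open null sets, of which countably many
  suffice by Lindelof's theorem.\<close>

lemma AE_law_support:
  fixes Z :: "'a \<Rightarrow> 'b::second_countable_topology"
  assumes [measurable]: "Z \<in> borel_measurable M"
  shows "AE \<omega> in M. Z \<omega> \<in> law_support M Z"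
proof -
  define \<U> where "\<U> = {U. open U \<and> prob {\<omega> \<in> space M. Z \<omega> \<in> U} = 0}"
  obtain \<U>' where \<U>': "\<U>' \<subseteq> \<U>" "countable \<U>'" "\<Union>\<U>' = \<Union>\<U>"
    using Lindelof[of \<U>] by (auto simp: \<U>_def)
  have "AE \<omega> in M. Z \<omega> \<notin> U" if "U \<in> \<U>'" for U
  proof -
    have [measurable]: "U \<in> sets borel" and null: "prob {\<omega> \<in> space M. Z \<omega> \<in> U} = 0"
      using that \<U>'(1) by (auto simp: \<U>_def)
    have "{\<omega> \<in> space M. Z \<omega> \<in> U} \<in> events"
      by measurable
    then have "AE \<omega> in M. \<omega> \<notin> {\<omega> \<in> space M. Z \<omega> \<in> U}"
      using null prob_eq_0 by blast
    then show ?thesis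
      using AE_space by eventually_elim auto
  qed
  then have "AE \<omega> in M. \<forall>U\<in>\<U>'. Z \<omega> \<notin> U"
    using \<U>'(2) by (simp add: AE_ball_countable)
  then show ?thesis
  proof eventually_elim
    case (elim \<omega>)
    then have "Z \<omega> \<notin> \<Union>\<U>"
      using \<U>'(3) by blast
    then show ?case
      by (auto simp: law_support_def \<U>_def zero_less_measure_iff)
  qed
qed

text \<open>Through this inclusion a finite support of \<open>X\<close> yields the finite set of
  atoms that serves as \<open>F\<close>.\<close>

lemma law_atoms_subset_law_support:
  fixes Z :: "'a \<Rightarrow> 'b::topological_space"
  assumes [measurable]: "Z \<in> borel_measurable M"
  shows "law_atoms M Z \<subseteq> law_support M Z"
proof
  fix z assume z: "z \<in> law_atoms M Z"
  have "prob {\<omega> \<in> space M. Z \<omega> \<in> U} > 0" if "open U" "z \<in> U" for U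
  proof -
    have [measurable]: "U \<in> sets borel"
      using that(1) by simp
    have "prob {\<omega> \<in> space M. Z \<omega> = z} \<le> prob {\<omega> \<in> space M. Z \<omega> \<in> U}"
      using that(2) by (intro finite_measure_mono) auto
    then show ?thesis
      using z by (simp add: law_atoms_def)
  qed
  then show "z \<in> law_support M Z"
    by (simp add: law_support_def)
qed

text \<open>An infinite width makes the final bound trivial; a finite one supplies the constants
  \<open>lo\<close> and \<open>hi\<close> of the locales.\<close>

lemma support_width_cases:
  assumes "Y \<in> borel_measurable M"
  obtains "support_width M Y = \<infinity>"
    | lo hi where "AE \<omega> in M. lo \<le> Y \<omega> \<and> Y \<omega> \<le> hi" "support_width M Y = ereal (hi - lo)"
proof -
  define S where "S = ereal ` law_support M Y"
  have AE: "AE \<omega> in M. Y \<omega> \<in> law_support M Y"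
    by (rule AE_law_support[OF assms])
  have width: "support_width M Y = Sup S - Inf S"
    by (simp add: support_width_def S_def)
  show ?thesis
  proof (cases "Sup S = \<infinity> \<or> Inf S = -\<infinity>")
    case True
    then have "support_width M Y = \<infinity>"
      unfolding width by (cases "Sup S"; cases "Inf S") auto
    then show ?thesis by (rule that(1))
  next
    case False
    \<comment> \<open>For a nonempty set the infimum is at most the supremum, so excluding one
      infinite value for each makes both finite.\<close>
    have "S \<noteq> {}"
    proof
      assume "S = {}"
      then have "AE \<omega> in M. False"
        using AE by (simp add: S_def)
      then show False by simp
    qed
    then have "Inf S \<le> Sup S"
      by (rule Inf_le_Sup)
    with False obtain lo hi where lo: "Inf S = ereal lo" and hi: "Sup S = ereal hi"
      by (cases "Sup S"; cases "Inf S") auto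
    have "lo \<le> y \<and> y \<le> hi" if "y \<in> law_support M Y" for y
    proof -
      have "ereal y \<in> S"
        using that by (simp add: S_def)
      then show ?thesis
        using Inf_lower[of "ereal y" S] Sup_upper[of "ereal y" S] by (simp add: lo hi)
    qed
    then have "AE \<omega> in M. lo \<le> Y \<omega> \<and> Y \<omega> \<le> hi"
      using AE by (auto elim: eventually_mono)
    then show ?thesis
      by (rule that(2)) (simp add: width lo hi)
  qed
qed

end

text \<open>\<open>TV_norm\<close> is an infimum that enters squared. Taking a root on the other
  side reduces the inequality to a lower bound for the infimum itself.\<close>

lemma ereal_le_mult_power2:
  fixes z :: ereal and m b :: real
  assumes "b > 0" "z \<ge> 0" "ereal (sqrt (m / b)) \<le> z"
  shows "ereal m \<le> ereal b * z\<^sup>2"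
proof (cases "m \<le> 0")
  case True
  then have "ereal m \<le> 0" by simp
  also have "0 \<le> ereal b * z\<^sup>2"
    using assms by (simp add: ereal_zero_le_0_iff)
  finally show ?thesis .
next
  case False
  have "ereal (m / b) = ereal (sqrt (m / b)) * ereal (sqrt (m / b))"
    using False assms(1) by simp
  also have "\<dots> \<le> z\<^sup>2"
    unfolding power2_eq_square using False assms by (intro ereal_mult_mono) auto
  finally have "ereal b * ereal (m / b) \<le> ereal b * z\<^sup>2"
    using assms(1) by (intro ereal_mult_left_mono) auto
  then show ?thesis
    using assms(1) by simp
qed

theorem theorem7:
  fixes M :: "'a measure" and d :: nat
    and X :: "'a \<Rightarrow> nat \<Rightarrow> real" and Y :: "'a \<Rightarrow> real" and N \<delta> :: real and k :: nat
    and \<pi> :: "nat \<Rightarrow> (nat \<Rightarrow> real) set set" and Mk :: "nat \<Rightarrow> 'a \<Rightarrow> real"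
  assumes "prob_space M" and "d \<ge> 1"
    and "X \<in> M \<rightarrow>\<^sub>M borel_Rd d"
    and "Y \<in> borel_measurable M" and "integrable M (\<lambda>\<omega>. (Y \<omega>)\<^sup>2)"
    and "purely_atomic M X" and "finite (law_support M X)"
    and "N > 0"
    and "\<forall>j\<in>{1..d}. \<forall>u. measure M {\<omega> \<in> space M. X \<omega> j = u} \<le> 1 / N"
    and "cyclic_minimax_split M d X Y \<pi>"
    and "associated_process M X Y \<pi> Mk"
    and "\<delta> > 0"
  shows "ereal (\<integral>\<omega>. (Y \<omega> - Mk k \<omega>)\<^sup>2 \<partial>M)
    \<le> ereal ((1 + 1 / \<delta>) * 2 powr (- 2 * real (k div d) / 3) * (2 ^ (k + 2) / (3 * N)))
          * (support_width M Y)\<^sup>2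
      + (INF g\<in>additive_BV d.
          ereal (((1 + \<delta>) + 2 * (1 + \<delta>) * (1 + 1 / \<delta>) / (3 * 2 powr (2 * real (k div d) / 3)))
                 * (\<integral>\<omega>. (Y \<omega> - g (X \<omega>))\<^sup>2 \<partial>M))
          + ereal ((1 + 1 / \<delta>) * (2 / 3 + ((1 + 1 / \<delta>) / 4) powr (2 / 3))
                   * 2 powr (- 2 * real (k div d) / 3))
            * (TV_norm d g)\<^sup>2)"
    (is "ereal ?L \<le> ereal ?C * _ + (INF g\<in>_. ereal (?A * ?e g) + ereal ?B * _)")
proof -
  interpret prob_space M by fact
  have C: "?C > 0" and B: "?B > 0"
    using \<open>\<delta> > 0\<close> \<open>N > 0\<close>
    by (intro mult_pos_pos divide_pos_pos add_pos_nonneg; simp)+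
  from support_width_cases[OF assms(4)] show ?thesis
  proof cases
    case 1
    \<comment> \<open>The first term is infinite, and so is its sum with any extended real.\<close>
    have "ereal c * (\<infinity>::ereal)\<^sup>2 = \<infinity>" if "c > 0" for c
      using that by (simp add: power2_eq_square)
    from this[OF C] show ?thesis
      unfolding 1 by simp
  next
    case (2 lo hi)
    define F where "F = law_atoms M X"
    \<comment> \<open>The support of \<open>X\<close> refers to the topology on all functions from
      the naturals; coordinates outside \<open>{1..d}\<close> are constantly
      \<open>undefined\<close>.\<close>
    have "X \<in> borel_measurable M"
    proof (rule measurable_coordinatewise_then_product)
      fix i
      show "(\<lambda>\<omega>. X \<omega> i) \<in> borel_measurable M"
      proof (cases "i \<in> {1..d}")
        case True
        then show ?thesis
          using measurable_compose[OF assms(3) measurable_component_singleton] by blast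
      next
        case False
        have "X \<omega> i = undefined" if "\<omega> \<in> space M" for \<omega>
          using measurable_space[OF assms(3) that] False by (auto simp: space_PiM PiE_def extensional_def)
        then show ?thesis
          by (subst measurable_cong[where g = "\<lambda>_. undefined"]) auto
      qed
    qed
    then have "finite F"
      using law_atoms_subset_law_support assms(7) by (auto simp: F_def intro: finite_subset)
    interpret regression_setting M Y lo hi d X N F
      using assms 2(1) \<open>finite F\<close> by unfold_locales (auto simp: F_def purely_atomic_def)
    \<comment> \<open>The first term is finite here, so it moves to the left and the infimum is
      bounded below one \<open>g\<close> at a time.\<close>
    have "ereal (?L - ?C * (hi - lo)\<^sup>2) \<le> (INF g\<in>additive_BV d.
        ereal (?A * ?e g) + ereal ?B * (TV_norm d g)\<^sup>2)"
    proof (rule INF_greatest)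
      fix g assume "g \<in> additive_BV d"
      \<comment> \<open>What the variation term still has to dominate; it may be negative.\<close>
      define m where "m = ?L - ?C * (hi - lo)\<^sup>2 - ?A * ?e g"
      have "0 \<le> TV_norm d g"
        unfolding TV_norm_def by (intro INF_greatest sum_nonneg total_variation_nonneg)
      moreover have "ereal (sqrt (m / ?B)) \<le> TV_norm d g"
        unfolding TV_norm_def
      proof (rule INF_greatest)
        fix h assume h: "h \<in> additive_reps d g"
        have BV: "total_variation (h i) < \<infinity>" if "i \<in> {1..d}" for i
          using h that by (simp add: additive_reps_def)
        have "g (X \<omega>) = additive h (X \<omega>)" if "\<omega> \<in> space M" for \<omega>
          using h measurable_space[OF X_measurable that] additive_def
          by (simp add: additive_reps_def space_PiM)
        then have e: "?e g = (\<integral>\<omega>. (Y \<omega> - additive h (X \<omega>))\<^sup>2 \<partial>M)"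
          by (intro Bochner_Integration.integral_cong) auto
        have "?L \<le> ?C * (hi - lo)\<^sup>2 + (?A * ?e g + ?B * (variation_norm h)\<^sup>2)"
        proof -
          define q :: real where "q = 2 powr (- 2 * real (k div d) / 3)"
          define s where "s = 2 / 3 + ((1 + 1 / \<delta>) / 4) powr (2 / 3)"
          define c where "c = 1 + 1 / \<delta>"
          \<comment> \<open>The constants of the statement are brought into the shape of
            \<open>cyclic_minimax_bound\<close>, with \<open>q * c\<close> factored out.\<close>
          have A_eq: "?A = (1 + \<delta>) + q * (c * (2 / 3 * (1 + \<delta>)))"
            by (simp add: q_def c_def powr_minus_divide mult_ac)
          have C_eq: "?C * (hi - lo)\<^sup>2 = q * (c * (2 / 3 * (2 ^ (k + 1) * ((hi - lo)\<^sup>2 / N))))"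
            by (simp add: q_def c_def)
          have B_eq: "?B * (variation_norm h)\<^sup>2 = q * (c * (s * (variation_norm h)\<^sup>2))"
            by (simp add: q_def c_def s_def)
          have "?L \<le> (1 + \<delta>) * ?e g + q * (c * (2 / 3 * (2 ^ (k + 1) * ((hi - lo)\<^sup>2 / N))
              + 2 / 3 * ((1 + \<delta>) * ?e g) + s * (variation_norm h)\<^sup>2))"
            using cyclic_minimax_bound[where h = h and k = k, OF BV assms(10-12)]
            unfolding e q_def c_def s_def .
          also have "\<dots> = ?C * (hi - lo)\<^sup>2 + (?A * ?e g + ?B * (variation_norm h)\<^sup>2)"
            unfolding A_eq B_eq C_eq by (simp only: distrib_left distrib_right mult_ac add_ac)
          finally show ?thesis .
        qed
        then have "m \<le> ?B * (variation_norm h)\<^sup>2"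
          unfolding m_def by linarith
        then have "m / ?B \<le> (variation_norm h)\<^sup>2"
          using B by (simp add: pos_divide_le_eq mult.commute)
        then have "sqrt (m / ?B) \<le> variation_norm h"
          using spread_nonneg[where h = h and A = "{}", OF BV] spread_le_variation_norm[where h = h and A = "{}", OF BV]
          by (intro real_le_lsqrt) auto
        moreover have "ereal (variation_norm h) = (\<Sum>i\<in>{1..d}. total_variation (h i))"
          using ereal_total_variation[OF BV] unfolding variation_norm_def sum_ereal[symmetric]
          by (intro sum.cong) auto
        ultimately show "ereal (sqrt (m / ?B)) \<le> (\<Sum>i\<in>{1..d}. total_variation (h i))"
          by (metis ereal_less_eq(3))
      qed
      ultimately have "ereal m \<le> ereal ?B * (TV_norm d g)\<^sup>2"
        using B by (intro ereal_le_mult_power2)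
      then have "ereal (?A * ?e g) + ereal m \<le> ereal (?A * ?e g) + ereal ?B * (TV_norm d g)\<^sup>2"
        by (rule add_left_mono)
      moreover have "ereal (?A * ?e g) + ereal m = ereal (?L - ?C * (hi - lo)\<^sup>2)"
        by (simp add: m_def)
      ultimately show "ereal (?L - ?C * (hi - lo)\<^sup>2)
          \<le> ereal (?A * ?e g) + ereal ?B * (TV_norm d g)\<^sup>2"
        by simp
    qed
    from add_left_mono[OF this, of "ereal ?C * (support_width M Y)\<^sup>2"]
    show ?thesis
      unfolding 2(2) by simp
  qed
qed

end
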